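(* Let $\mathcal{L}=\{1,\dots,d\}$, let $x:[0,T]\to\mathbb{R}^d$ be a $C^1$ path with coordinates $(x^a)_{a\in\mathcal{L}}$, let $\eta\in\mathbb{R}^n$, and let $f_a:\mathbb{R}^n\to\mathbb{R}^n$, $a\in\mathcal{L}$, be analytic vector fields (with a common analyticity radius $R>0$ around $\eta$ for all their coordinates). Then the solution $y$ of the differential equation $$dy_t=\sum_{a\in\mathcal{L}}f_a(y_t)\,dx^a_t,\qquad y_0=\eta,$$ admits locally the series representation $$y_t-y_s=\sum_{\tau\in\mathcal{T}_{\mathcal{L}}}\frac{1}{\sigma(\tau)}\,\phi^f(\tau)(y_s)\,X^\tau_{ts};$$ that is, there is $t_*>0$ such that this identity holds (with convergent series) for all $s,t\in[0,T]\cap[0,t_* )$.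
   Context: An $\mathcal{L}$-labeled rooted tree is a finite rooted tree (order of branches irrelevant) each of whose vertices carries a label in $\mathcal{L}$; $\mathcal{T}_{\mathcal{L}}$ is the set of these trees. $\bullet_a$ is the one-vertex tree with label $a$ and $[\tau^1\cdots\tau^k]_a$ is the tree obtained by attaching the roots of $\tau^1,\dots,\tau^k$ to a new root with label $a$. Symmetry factor: $\sigma(\bullet_a)=1$ and $\sigma([\tau^1\cdots\tau^k]_a)=\frac{k!}{\delta(\tau^1,\dots,\tau^k)}\sigma(\tau^1)\cdots\sigma(\tau^k)$, where $\delta(\tau^1,\dots,\tau^k)$ is the number of distinct ordered $k$-tuples that are rearrangements of $(\tau^1,\dots,\tau^k)$. Iterated integrals: $X^{\bullet_a}_{ts}=\int_s^tdx^a_u$, $X^{[\tau^1\cdots\tau^k]_a}_{ts}=\int_s^t\prod_{i=1}^kX^{\tau^i}_{us}\,dx^a_u$. Coefficients $\phi^f:\mathcal{T}_{\mathcal{L}}\times\mathbb{R}^n\to\mathbb{R}^n$: $\phi^f(\bullet_a)(\xi)=f_a(\xi)$ and $$\phi^f([\tau^1\cdots\tau^k]_a)(\xi)=\sum_{b_1,\dots,b_k=1}^n f_{a;b_1\dots b_k}(\xi)\prod_{i=1}^k[\phi^f(\tau^i)(\xi)]^{b_i},$$ where $f_{a;b_1\dots b_k}=\partial_{\xi_{b_1}}\cdots\partial_{\xi_{b_k}}f_a$ and $[v]^b$ denotes the $b$-th coordinate of $v\in\mathbb{R}^n$. Sums over the countable set $\mathcal{T}_{\mathcal{L}}$ are unordered,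 hence understood as absolutely convergent series. *)

theory Defs
  imports
    "HOL-Analysis.Analysis"
    "HOL-Library.Multiset"
    "HOL-Combinatorics.Multiset_Permutations"
begin

text \<open>Finite rooted trees with labelled vertices. The branches at a vertex form a multiset, so their
  order is irrelevant. The one-vertex tree labelled \<open>a\<close> is \<open>Node a {#}\<close>; every formula below covers
  it as the case of no branches.\<close>

datatype 'l ltree = Node 'l "'l ltree multiset"

text \<open>The set \<open>permutations_of_multiset \<tau>s\<close> consists of the lists \<open>l\<close> with \<open>mset l = \<tau>s\<close>, so its
  cardinality is the number of distinct rearrangements of the branches.\<close>

primrec symmetry_factor :: "'l ltree \<Rightarrow> real" where
  "symmetry_factor (Node a \<tau>s) =
     fact (size \<tau>s) / real (card (permutations_of_multiset \<tau>s)) *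
     (\<Prod>\<tau>\<in>#\<tau>s. symmetry_factor \<tau>)"

text \<open>Paths on \<open>{0..T}\<close> have one-sided derivatives at the end points (unlike in
  \<open>C1_differentiable_on\<close>, which uses two-sided ones).\<close>

definition C1_path :: "real \<Rightarrow> (real \<Rightarrow> 'v::real_normed_vector) \<Rightarrow> bool" where
  "C1_path T x \<longleftrightarrow> (\<exists>x'. (\<forall>t\<in>{0..T}. (x has_vector_derivative x' t) (at t within {0..T})) \<and>
                        continuous_on {0..T} x')"

definition velocity :: "real \<Rightarrow> (real \<Rightarrow> 'v::real_normed_vector) \<Rightarrow> real \<Rightarrow> 'v" where
  "velocity T x t = vector_derivative x (at t within {0..T})"

text \<open>\<open>iterated_integral T x \<tau> s t\<close> is \<open>X\<^sup>\<tau>\<^sub>t\<^sub>s\<close>, with \<open>dx\<^sup>a\<^sub>u\<close> read as \<open>(velocity T x u $ a) du\<close>. The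
  integral from \<open>s\<close> to \<open>t\<close> is oriented, also when \<open>t < s\<close>.\<close>

primrec iterated_integral ::
  "real \<Rightarrow> (real \<Rightarrow> real ^ 'd) \<Rightarrow> 'd ltree \<Rightarrow> real \<Rightarrow> real \<Rightarrow> real" where
  "iterated_integral T x (Node a \<tau>s) = (\<lambda>s t.
     LBINT u=s..t. (\<Prod>\<tau>\<in>#\<tau>s. iterated_integral T x \<tau> s u) * velocity T x u $ a)"

definition partial_deriv ::
  "'n \<Rightarrow> (real ^ 'n \<Rightarrow> 'v::real_normed_vector) \<Rightarrow> real ^ 'n \<Rightarrow> 'v" where
  "partial_deriv b g \<xi> = vector_derivative (\<lambda>h. g (\<xi> + h *\<^sub>R axis b 1)) (at 0)"

text \<open>\<open>foldr partial_deriv [b\<^sub>1, \<dots>, b\<^sub>k] g\<close> is \<open>\<partial>\<^bsub>b\<^sub>1\<^esub> \<dots> \<partial>\<^bsub>b\<^sub>k\<^esub> g\<close>.\<close>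

definition derivative_sum ::
  "(real ^ 'n \<Rightarrow> 'v::real_normed_vector) \<Rightarrow> real ^ 'n \<Rightarrow> (real ^ 'n) list \<Rightarrow> 'v" where
  "derivative_sum g \<xi> vs =
     (\<Sum>bs | length bs = length vs. (\<Prod>i<length vs. vs ! i $ bs ! i) *\<^sub>R foldr partial_deriv bs g \<xi>)"

text \<open>The formula for \<open>\<phi>\<^sup>f\<close> at a vertex needs an enumeration of the branches, or rather of
  the functions \<open>\<phi>\<^sup>f(\<tau>\<^sup>i)\<close> belonging to them. We choose an arbitrary one; for smooth vector fields the partial
  derivatives commute and the choice does not matter.\<close>

primrec elementary_differential ::
  "('l \<Rightarrow> real ^ 'n \<Rightarrow> real ^ 'n) \<Rightarrow> 'l ltree \<Rightarrow> real ^ 'n \<Rightarrow> real ^ 'n" where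
  "elementary_differential f (Node a \<tau>s) = (\<lambda>\<xi>.
     derivative_sum (f a) \<xi>
       (map (\<lambda>\<phi>. \<phi> \<xi>) (SOME \<phi>s. mset \<phi>s = image_mset (elementary_differential f) \<tau>s)))"

text \<open>Multi-indices are functions \<open>\<alpha> :: 'n \<Rightarrow> nat\<close>. The sum over them is unordered, i.e. the power
  series converges absolutely on the ball.\<close>

definition power_series_on_ball :: "(real ^ 'n \<Rightarrow> real) \<Rightarrow> real ^ 'n \<Rightarrow> real \<Rightarrow> bool" where
  "power_series_on_ball g p r \<longleftrightarrow>
     (\<exists>c :: ('n \<Rightarrow> nat) \<Rightarrow> real. \<forall>\<xi>\<in>ball p r.
        ((\<lambda>\<alpha>. c \<alpha> * (\<Prod>i\<in>UNIV. ((\<xi> - p) $ i) ^ \<alpha> i)) has_sum g \<xi>) UNIV)"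

definition real_analytic :: "(real ^ 'n \<Rightarrow> real) \<Rightarrow> bool" where
  "real_analytic g \<longleftrightarrow> (\<forall>p. \<exists>r>0. power_series_on_ball g p r)"

text \<open>\<open>y\<close> solves \<open>dy\<^sub>t = \<Sum>\<^sub>a f\<^sub>a(y\<^sub>t) dx\<^sup>a\<^sub>t\<close>, \<open>y\<^sub>0 = \<eta>\<close> on the subinterval \<open>I\<close> of \<open>{0..T}\<close>, on which
  \<open>x\<close> is defined.\<close>

definition solves_on ::
  "real \<Rightarrow> (real \<Rightarrow> real ^ 'd) \<Rightarrow> ('d \<Rightarrow> real ^ 'n \<Rightarrow> real ^ 'n) \<Rightarrow> real ^ 'n \<Rightarrow>
   (real \<Rightarrow> real ^ 'n) \<Rightarrow> real set \<Rightarrow> bool" where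
  "solves_on T x f \<eta> y I \<longleftrightarrow>
     y 0 = \<eta> \<and>
     (\<forall>t\<in>I. (y has_vector_derivative (\<Sum>a\<in>UNIV. (velocity T x t $ a) *\<^sub>R f a (y t))) (at t within I))"

end

theory Submission imports Defs begin

text \<open>Expand \<open>f\<^sub>a\<close> in its Taylor series at \<open>y\<^sub>s\<close> and insert \<open>v = \<Sum>\<^sub>\<tau> \<phi>\<^sup>f(\<tau>) X\<^sup>\<tau> / \<sigma>(\<tau>)\<close>.
  Multiplying out yields a sum over lists of trees; grouping the lists by the multiset of their entries turns it into
  the sum over all trees with root label \<open>a\<close>, the factor \<open>1 / \<sigma>\<close> counting the rearrangements. Hence the
  tree series, whose terms are differentiated one by one, formally solves the differential equation.
  For convergence, bound \<open>\<bar>X\<^sup>\<tau>\<bar>\<close> by a multiplicative weight. The same expansion shows that if the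
  absolute series over the trees of height at most \<open>k\<close> is below \<open>\<rho> / 2\<close>, then so is the one for height
  \<open>k + 1\<close>, provided the time interval is short; no estimate of individual coefficients is needed. On a short interval
  the vector field is Lipschitz with a small enough constant for the distance between the solution and the series to be
  at most half of itself.\<close>

text \<open>The base point \<open>y s\<close> moves with s, while the radius of analyticity is given
  at \<eta>. One pair of constants \<rho>, N has to serve every base point: moving the centre of a
  power series inside its box costs radius but preserves the bound N on its absolute sum, because
  the old and the new series sum one double family in two orders. Elementary differentials sum over
  ordered tuples of coordinates. The Taylor series is therefore written over words of coordinates
  instead of multi-indices, the coefficient of a multi-index being shared equally among its words.
  Multiplying out powers of a tree series then pairs a word with a list of trees of the same length,
  and a simultaneous permutation of both changes nothing. The resulting identity
  \<open>branch_sum\<close> leaves the numbers attached to the trees arbitrary: with the weights it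
  gives convergence, with the iterated integrals it gives the differential equation.\<close>

no_notation Infinite_Set_Sum.abs_summable_on (infix "abs'_summable'_on" 50)

section \<open>Absolutely summable families with a bound on their sum\<close>

text \<open>Summability is part of the notion because \<open>infsum\<close> is 0 on a family that is
  not summable, where a bound for it would say nothing.\<close>

definition norm_sum_le :: "('a \<Rightarrow> 'b::real_normed_vector) \<Rightarrow> 'a set \<Rightarrow> real \<Rightarrow> bool" where
  "norm_sum_le f A N \<longleftrightarrow> f abs_summable_on A \<and> (\<Sum>\<^sub>\<infinity>x\<in>A. norm (f x)) \<le> N"

lemma norm_sum_leI:
  assumes "((\<lambda>x. norm (f x)) has_sum S) A" "S \<le> N"
  shows "norm_sum_le f A N"
  using assms by (auto simp: norm_sum_le_def has_sum_iff)

lemma norm_sum_le_abs_summable: "norm_sum_le f A N \<Longrightarrow> f abs_summable_on A"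
  by (simp add: norm_sum_le_def)

lemma norm_sum_le_summable:
  fixes f :: "'a \<Rightarrow> 'b::banach"
  shows "norm_sum_le f A N \<Longrightarrow> f summable_on A"
  by (simp add: norm_sum_le_def abs_summable_summable)

lemma norm_sum_le_nonneg: "norm_sum_le f A N \<Longrightarrow> 0 \<le> N"
  unfolding norm_sum_le_def by (meson infsum_nonneg norm_ge_zero order_trans)

lemma norm_sum_le_norm_has_sum:
  assumes "norm_sum_le f A N" "(f has_sum a) A"
  shows "norm a \<le> N"
  using assms norm_has_sum_bound[OF _ assms(2)] unfolding norm_sum_le_def has_sum_iff by auto

lemma norm_sum_le_weaken: "norm_sum_le f A N \<Longrightarrow> N \<le> N' \<Longrightarrow> norm_sum_le f A N'"
  by (simp add: norm_sum_le_def)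

lemma norm_sum_le_comparison:
  assumes "norm_sum_le g A N" "\<And>x. x \<in> A \<Longrightarrow> norm (f x) \<le> norm (g x)"
  shows "norm_sum_le f A N"
proof -
  have "f abs_summable_on A"
    using assms Infinite_Sum.abs_summable_on_comparison_test unfolding norm_sum_le_def by blast
  moreover have "(\<Sum>\<^sub>\<infinity>x\<in>A. norm (f x)) \<le> (\<Sum>\<^sub>\<infinity>x\<in>A. norm (g x))"
    using assms calculation unfolding norm_sum_le_def by (intro infsum_mono) auto
  ultimately show ?thesis using assms unfolding norm_sum_le_def by auto
qed

lemma norm_sum_le_subset:
  assumes "norm_sum_le f A N" "B \<subseteq> A"
  shows "norm_sum_le f B N"
proof -
  have "f abs_summable_on B"
    using assms summable_on_subset_banach unfolding norm_sum_le_def by blast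
  moreover have "(\<Sum>\<^sub>\<infinity>x\<in>B. norm (f x)) \<le> (\<Sum>\<^sub>\<infinity>x\<in>A. norm (f x))"
    using assms calculation unfolding norm_sum_le_def by (intro infsum_mono2) auto
  ultimately show ?thesis using assms unfolding norm_sum_le_def by auto
qed

text \<open>A condition on finite subsets alone carries a bound that is uniform over the stages of
  trees to the set of all trees.\<close>

lemma norm_sum_le_finite_sums:
  "norm_sum_le f A N \<longleftrightarrow> (\<forall>F. finite F \<longrightarrow> F \<subseteq> A \<longrightarrow> (\<Sum>x\<in>F. norm (f x)) \<le> N)"
proof safe
  fix F assume "norm_sum_le f A N" "finite F" "F \<subseteq> A"
  then show "(\<Sum>x\<in>F. norm (f x)) \<le> N"
    using finite_sum_le_infsum[of "\<lambda>x. norm (f x)" A F] unfolding norm_sum_le_def by auto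
next
  assume *: "\<forall>F. finite F \<longrightarrow> F \<subseteq> A \<longrightarrow> (\<Sum>x\<in>F. norm (f x)) \<le> N"
  then have "f abs_summable_on A"
    unfolding abs_summable_iff_bdd_above by (auto intro!: bdd_aboveI2)
  with * show "norm_sum_le f A N"
    unfolding norm_sum_le_def by (auto intro: infsum_le_finite_sums)
qed

lemma norm_sum_le_reindex:
  assumes "bij_betw g A B"
  shows "norm_sum_le (\<lambda>x. f (g x)) A N \<longleftrightarrow> norm_sum_le f B N"
  unfolding norm_sum_le_def
  using summable_on_reindex_bij_betw[OF assms, of "\<lambda>x. norm (f x)"]
    infsum_reindex_bij_betw[OF assms, of "\<lambda>x. norm (f x)"] by simp

text \<open>Tonelli: exact sums of the norms on the fibres, together with a bound for their total,
  control the whole family.\<close>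

lemma norm_sum_le_Sigma:
  assumes "\<And>x. x \<in> A \<Longrightarrow> ((\<lambda>y. norm (f (x, y))) has_sum b x) (B x)" "norm_sum_le b A N"
  shows "norm_sum_le f (Sigma A B) N"
proof -
  have b: "b x \<ge> 0" if "x \<in> A" for x
    using assms(1)[OF that] by (rule has_sum_nonneg) auto
  have 1: "b summable_on A" using assms(2) by (rule norm_sum_le_summable)
  have 2: "infsum b A \<le> N"
  proof -
    have "infsum b A = (\<Sum>\<^sub>\<infinity>x\<in>A. norm (b x))" using b by (intro infsum_cong) auto
    then show ?thesis using assms(2) by (simp add: norm_sum_le_def)
  qed
  have "f abs_summable_on Sigma A B"
    by (rule summable_on_SigmaI[OF assms(1) 1]) auto
  then have "((\<lambda>p. norm (f p)) has_sum infsum b A) (Sigma A B)"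
    by (intro has_sum_SigmaI[OF assms(1)]) (use 1 in auto)
  then show ?thesis using 2 by (rule norm_sum_leI)
qed

text \<open>The triangle inequality in each block keeps the bound. Recentring a power series and
  passing from lists to multisets both obtain their bound in this way.\<close>

lemma norm_sum_le_SigmaD:
  fixes f :: "'a \<times> 'b \<Rightarrow> 'c::banach"
  assumes "norm_sum_le f (Sigma A B) N" "\<And>x. x \<in> A \<Longrightarrow> ((\<lambda>y. f (x, y)) has_sum b x) (B x)"
  shows "norm_sum_le b A N"
proof -
  have s: "f abs_summable_on Sigma A B" using assms(1) by (simp add: norm_sum_le_def)
  then have 1: "(\<lambda>y. f (x, y)) abs_summable_on B x" if "x \<in> A" for x
    using that by (simp add: Infinite_Sum.abs_summable_on_Sigma_iff)
  let ?b = "\<lambda>x. \<Sum>\<^sub>\<infinity>y\<in>B x. norm (f (x, y))"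
  have "((\<lambda>p. norm (f p)) has_sum (\<Sum>\<^sub>\<infinity>p\<in>Sigma A B. norm (f p))) (Sigma A B)"
    using s by simp
  then have "(?b has_sum (\<Sum>\<^sub>\<infinity>p\<in>Sigma A B. norm (f p))) A"
    by (rule has_sum_SigmaD) (use 1 in auto)
  then have "norm_sum_le ?b A N"
    using assms(1) unfolding norm_sum_le_def
    by (auto simp: has_sum_iff infsum_nonneg)
  then show ?thesis
  proof (rule norm_sum_le_comparison)
    fix x assume "x \<in> A"
    then have "norm (b x) \<le> ?b x"
      using norm_has_sum_bound[OF has_sum_infsum[OF 1] assms(2)] by blast
    then show "norm (b x) \<le> norm (?b x)" by simp
  qed
qed

lemma abs_summable_Sigma_slice:
  assumes "f abs_summable_on Sigma A B" "x \<in> A"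
  shows "(\<lambda>y. f (x, y)) abs_summable_on B x"
  using assms by (simp add: Infinite_Sum.abs_summable_on_Sigma_iff)

section \<open>Multi-index power series\<close>

definition monom_at :: "real ^ 'n \<Rightarrow> ('n \<Rightarrow> nat) \<Rightarrow> real" where
  "monom_at w \<alpha> = (\<Prod>i\<in>UNIV. (w $ i) ^ \<alpha> i)"

text \<open>The box is a closed ball of the maximum norm. All monomials attain their largest modulus
  on it at the corner (r, ..., r), so the bound N for the absolute sum at that corner dominates the
  series on the whole box.\<close>

definition series_on_box ::
  "(('n \<Rightarrow> nat) \<Rightarrow> 'v) \<Rightarrow> real \<Rightarrow> real \<Rightarrow> (real ^ 'n \<Rightarrow> 'v::real_normed_vector) \<Rightarrow> real ^ 'n \<Rightarrow> bool"
  where "series_on_box c r N g p \<longleftrightarrow>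
     norm_sum_le (\<lambda>\<alpha>. r ^ sum \<alpha> UNIV *\<^sub>R c \<alpha>) UNIV N \<and>
     (\<forall>w. (\<forall>i. \<bar>w $ i\<bar> \<le> r) \<longrightarrow> ((\<lambda>\<alpha>. monom_at w \<alpha> *\<^sub>R c \<alpha>) has_sum g (p + w)) UNIV)"

lemma abs_monom_at_le:
  assumes "\<And>i. \<bar>w $ i\<bar> \<le> r"
  shows "\<bar>monom_at w \<alpha>\<bar> \<le> r ^ sum \<alpha> UNIV"
  unfolding monom_at_def abs_prod power_sum
  by (intro prod_mono) (auto simp: power_abs intro!: power_mono assms)

lemma monom_at_const [simp]: "monom_at (\<chi> i. r) \<alpha> = r ^ sum \<alpha> UNIV"
  by (simp add: monom_at_def power_sum)

lemma finite_atMost_multiindex: "finite {..\<alpha> :: 'n::finite \<Rightarrow> nat}"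
proof -
  have "{..\<alpha>} = PiE UNIV (\<lambda>i. {..\<alpha> i})" by (auto simp: le_fun_def PiE_def Pi_def)
  then show ?thesis by (simp add: finite_PiE)
qed

lemma sum_multiindex_binomial:
  fixes a b :: "'n::finite \<Rightarrow> real"
  shows "(\<Sum>\<beta>\<in>{..\<alpha>}. \<Prod>i\<in>UNIV. real (\<alpha> i choose \<beta> i) * a i ^ (\<alpha> i - \<beta> i) * b i ^ \<beta> i)
       = (\<Prod>i\<in>UNIV. (a i + b i) ^ \<alpha> i)"
proof -
  have *: "{..\<alpha>} = PiE UNIV (\<lambda>i. {..\<alpha> i})" by (auto simp: le_fun_def PiE_def Pi_def)
  have "(a i + b i) ^ \<alpha> i = (\<Sum>k\<le>\<alpha> i. real (\<alpha> i choose k) * a i ^ (\<alpha> i - k) * b i ^ k)" for i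
    using binomial_ring[of "b i" "a i" "\<alpha> i"] by (simp add: add.commute mult.assoc mult.left_commute mult.commute)
  then show ?thesis unfolding * by (simp add: prod_sum_PiE)
qed

text \<open>The coefficient of v^\<beta> after each (w + v)^\<alpha> is multiplied out, with
  \<alpha> = \<gamma> + \<beta>; inside the box it is the \<beta>-th derivative at p + w divided by
  \<beta>!.\<close>

definition recentre :: "(('n \<Rightarrow> nat) \<Rightarrow> 'v::real_normed_vector) \<Rightarrow> real ^ 'n \<Rightarrow> ('n \<Rightarrow> nat) \<Rightarrow> 'v" where
  "recentre c w \<beta> = (\<Sum>\<^sub>\<infinity>\<gamma>. (\<Prod>i\<in>UNIV. real (\<gamma> i + \<beta> i choose \<beta> i) * (w $ i) ^ \<gamma> i) *\<^sub>R c (\<lambda>i. \<gamma> i + \<beta> i))"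

text \<open>For fixed \<alpha> the binomial theorem, applied to the moduli of the entries, adds the
  norms up to at most r^|\<alpha>| times the norm of c \<alpha>. Hence multiplying out does not
  increase the bound.\<close>

lemma norm_sum_le_binomial_family:
  fixes c :: "('n::finite \<Rightarrow> nat) \<Rightarrow> 'v::banach"
  assumes "norm_sum_le (\<lambda>\<alpha>. r ^ sum \<alpha> UNIV *\<^sub>R c \<alpha>) UNIV N" "\<And>i. \<bar>w $ i\<bar> + \<bar>v $ i\<bar> \<le> r"
  shows "norm_sum_le (\<lambda>(\<alpha>, \<beta>). (\<Prod>i\<in>UNIV. real (\<alpha> i choose \<beta> i) * (w $ i) ^ (\<alpha> i - \<beta> i) * (v $ i) ^ \<beta> i) *\<^sub>R c \<alpha>)
           (SIGMA \<alpha>:UNIV. {..\<alpha>}) N" (is "norm_sum_le ?F _ N")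
proof (rule norm_sum_le_Sigma)
  let ?b = "\<lambda>\<alpha>. (\<Prod>i\<in>UNIV. (\<bar>w $ i\<bar> + \<bar>v $ i\<bar>) ^ \<alpha> i) * norm (c \<alpha>)"
  fix \<alpha> :: "'n \<Rightarrow> nat"
  have "(\<Sum>\<beta>\<in>{..\<alpha>}. norm (?F (\<alpha>, \<beta>))) = ?b \<alpha>"
    unfolding sum_multiindex_binomial[symmetric] sum_distrib_right
    by (simp add: abs_prod abs_mult power_abs)
  then show "((\<lambda>\<beta>. norm (?F (\<alpha>, \<beta>))) has_sum ?b \<alpha>) {..\<alpha>}"
    by (intro has_sum_finiteI finite_atMost_multiindex) auto
next
  show "norm_sum_le (\<lambda>\<alpha>. (\<Prod>i\<in>UNIV. (\<bar>w $ i\<bar> + \<bar>v $ i\<bar>) ^ \<alpha> i) * norm (c \<alpha>)) UNIV N"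
  proof (rule norm_sum_le_comparison[OF assms(1)])
    fix \<alpha> :: "'n \<Rightarrow> nat"
    have "(\<Prod>i\<in>UNIV. (\<bar>w $ i\<bar> + \<bar>v $ i\<bar>) ^ \<alpha> i) \<le> r ^ sum \<alpha> UNIV"
      unfolding power_sum by (intro prod_mono) (auto intro!: power_mono assms)
    moreover have "0 \<le> (\<Prod>i\<in>UNIV. (\<bar>w $ i\<bar> + \<bar>v $ i\<bar>) ^ \<alpha> i)" by (intro prod_nonneg) auto
    ultimately show "norm ((\<Prod>i\<in>UNIV. (\<bar>w $ i\<bar> + \<bar>v $ i\<bar>) ^ \<alpha> i) * norm (c \<alpha>)) \<le> norm (r ^ sum \<alpha> UNIV *\<^sub>R c \<alpha>)"
      by (simp add: abs_mult mult_right_mono)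
  qed
qed

lemma bij_betw_multiindex_shift:
  "bij_betw (\<lambda>(\<beta>, \<gamma>). (\<lambda>i. \<gamma> i + \<beta> i, \<beta>)) (UNIV \<times> UNIV) (SIGMA \<alpha>:UNIV. {..\<alpha> :: 'n \<Rightarrow> nat})"
  by (rule bij_betwI[where g = "\<lambda>(\<alpha>, \<beta>). (\<beta>, \<lambda>i. \<alpha> i - \<beta> i)"]) (auto simp: le_fun_def fun_eq_iff)

lemma norm_sum_le_shifted_family:
  fixes c :: "('n::finite \<Rightarrow> nat) \<Rightarrow> 'v::banach"
  assumes "norm_sum_le (\<lambda>\<alpha>. r ^ sum \<alpha> UNIV *\<^sub>R c \<alpha>) UNIV N" "\<And>i. \<bar>w $ i\<bar> + \<bar>v $ i\<bar> \<le> r"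
  shows "norm_sum_le (\<lambda>(\<beta>, \<gamma>). monom_at v \<beta> *\<^sub>R
           ((\<Prod>i\<in>UNIV. real (\<gamma> i + \<beta> i choose \<beta> i) * (w $ i) ^ \<gamma> i) *\<^sub>R c (\<lambda>i. \<gamma> i + \<beta> i)))
           (UNIV \<times> UNIV) N"
  using norm_sum_le_binomial_family[OF assms]
  unfolding norm_sum_le_reindex[OF bij_betw_multiindex_shift, symmetric]
  by (simp add: case_prod_unfold monom_at_def prod.distrib mult.commute)

lemma recentre_has_sum:
  fixes c :: "('n::finite \<Rightarrow> nat) \<Rightarrow> 'v::banach"
  assumes "norm_sum_le (\<lambda>\<alpha>. r ^ sum \<alpha> UNIV *\<^sub>R c \<alpha>) UNIV N" "\<And>i. \<bar>w $ i\<bar> + \<rho> \<le> r" "\<rho> > 0"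
  shows "(\<lambda>\<gamma>. (\<Prod>i\<in>UNIV. real (\<gamma> i + \<beta> i choose \<beta> i) * (w $ i) ^ \<gamma> i) *\<^sub>R c (\<lambda>i. \<gamma> i + \<beta> i)) abs_summable_on UNIV"
    and "((\<lambda>\<gamma>. (\<Prod>i\<in>UNIV. real (\<gamma> i + \<beta> i choose \<beta> i) * (w $ i) ^ \<gamma> i) *\<^sub>R c (\<lambda>i. \<gamma> i + \<beta> i)) has_sum recentre c w \<beta>) UNIV"
proof -
  let ?G = "\<lambda>\<gamma>. (\<Prod>i\<in>UNIV. real (\<gamma> i + \<beta> i choose \<beta> i) * (w $ i) ^ \<gamma> i) *\<^sub>R c (\<lambda>i. \<gamma> i + \<beta> i)"
  \<comment> \<open>The increment (\<rho>, ..., \<rho>) has nonzero entries, so its monomial can be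
    divided out of the slice at \<beta>.\<close>
  have "\<bar>w $ i\<bar> + \<bar>(\<chi> i. \<rho>) $ i\<bar> \<le> r" for i using assms(2)[of i] assms(3) by simp
  from abs_summable_Sigma_slice[OF norm_sum_le_abs_summable[OF norm_sum_le_shifted_family[OF assms(1) this]], of \<beta>]
  have "(\<lambda>\<gamma>. \<rho> ^ sum \<beta> UNIV *\<^sub>R ?G \<gamma>) abs_summable_on UNIV"
    by (simp only: UNIV_I prod.case monom_at_const simp_thms)
  then have "(\<lambda>\<gamma>. inverse (\<rho> ^ sum \<beta> UNIV) * norm (\<rho> ^ sum \<beta> UNIV *\<^sub>R ?G \<gamma>)) summable_on UNIV"
    by (rule summable_on_cmult_right)
  have *: "inverse (\<rho> ^ sum \<beta> UNIV) * norm (\<rho> ^ sum \<beta> UNIV *\<^sub>R x) = norm x" for x :: 'v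
    using assms(3) by (simp add: mult.assoc[symmetric])
  show "?G abs_summable_on UNIV"
    using \<open>(\<lambda>\<gamma>. inverse _ * norm _) summable_on UNIV\<close> unfolding * .
  then show "(?G has_sum recentre c w \<beta>) UNIV"
    unfolding recentre_def by (rule has_sum_infsum[OF abs_summable_summable])
qed

text \<open>Summed over \<beta> first, for fixed \<alpha>, the family returns g; summed over
  \<gamma> first, it gives the new coefficients. Both orders share the bound N.\<close>

lemma series_on_box_recentre:
  fixes c :: "('n::finite \<Rightarrow> nat) \<Rightarrow> 'v::banach"
  assumes "series_on_box c r N g p" "\<And>i. \<bar>w $ i\<bar> + \<rho> \<le> r" "\<rho> > 0"
  shows "series_on_box (recentre c w) \<rho> N g (p + w)"
proof -
  have c: "norm_sum_le (\<lambda>\<alpha>. r ^ sum \<alpha> UNIV *\<^sub>R c \<alpha>) UNIV N"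
    using assms(1) by (simp add: series_on_box_def)
  let ?H = "\<lambda>v. \<lambda>(\<beta>, \<gamma>). monom_at v \<beta> *\<^sub>R
           ((\<Prod>i\<in>UNIV. real (\<gamma> i + \<beta> i choose \<beta> i) * (w $ i) ^ \<gamma> i) *\<^sub>R c (\<lambda>i. \<gamma> i + \<beta> i))"
  have H: "norm_sum_le (?H v) (UNIV \<times> UNIV) N" if v: "\<forall>i. \<bar>v $ i\<bar> \<le> \<rho>" for v
    using v assms(2) by (intro norm_sum_le_shifted_family[OF c]) (meson add_left_mono order_trans)
  have inner: "((\<lambda>\<gamma>. ?H v (\<beta>, \<gamma>)) has_sum monom_at v \<beta> *\<^sub>R recentre c w \<beta>) UNIV" for v \<beta>
    unfolding prod.case
    by (intro has_sum_bounded_linear[OF bounded_linear_scaleR_right, unfolded o_def] recentre_has_sum(2)[OF c assms(2,3)])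
  have "norm_sum_le (\<lambda>\<beta>. monom_at (\<chi> i. \<rho>) \<beta> *\<^sub>R recentre c w \<beta>) UNIV N"
    by (rule norm_sum_le_SigmaD[OF H inner]) (use assms(3) in simp)
  then have "norm_sum_le (\<lambda>\<beta>. \<rho> ^ sum \<beta> UNIV *\<^sub>R recentre c w \<beta>) UNIV N"
    by (simp only: monom_at_const)
  moreover have "((\<lambda>\<beta>. monom_at v \<beta> *\<^sub>R recentre c w \<beta>) has_sum g (p + w + v)) UNIV"
    if v: "\<forall>i. \<bar>v $ i\<bar> \<le> \<rho>" for v
  proof -
    let ?F = "\<lambda>(\<alpha>, \<beta>). (\<Prod>i\<in>UNIV. real (\<alpha> i choose \<beta> i) * (w $ i) ^ (\<alpha> i - \<beta> i) * (v $ i) ^ \<beta> i) *\<^sub>R c \<alpha>"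
    have le: "\<bar>w $ i\<bar> + \<bar>v $ i\<bar> \<le> r" for i using v assms(2)[of i] by (meson add_left_mono order_trans)
    have Fs: "?F summable_on (SIGMA \<alpha>:UNIV. {..\<alpha>})"
      by (rule norm_sum_le_summable[OF norm_sum_le_binomial_family[OF c le]])
    have "\<forall>i. \<bar>(w + v) $ i\<bar> \<le> r"
      using le by (auto intro: order_trans[OF abs_triangle_ineq])
    then have "((\<lambda>\<alpha>. monom_at (w + v) \<alpha> *\<^sub>R c \<alpha>) has_sum g (p + (w + v))) UNIV"
      using assms(1) unfolding series_on_box_def by blast
    moreover have "((\<lambda>\<beta>. ?F (\<alpha>, \<beta>)) has_sum monom_at (w + v) \<alpha> *\<^sub>R c \<alpha>) {..\<alpha>}" for \<alpha>
    proof (rule has_sum_finiteI[OF finite_atMost_multiindex])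
      show "monom_at (w + v) \<alpha> *\<^sub>R c \<alpha> = (\<Sum>\<beta>\<in>{..\<alpha>}. ?F (\<alpha>, \<beta>))"
        unfolding monom_at_def vector_add_component sum_multiindex_binomial[symmetric] scaleR_sum_left
        by simp
    qed
    ultimately have "(?F has_sum g (p + (w + v))) (SIGMA \<alpha>:UNIV. {..\<alpha>})"
      by (intro has_sum_SigmaI[OF _ _ Fs])
    then have "(?H v has_sum g (p + (w + v))) (UNIV \<times> UNIV)"
      unfolding has_sum_reindex_bij_betw[OF bij_betw_multiindex_shift, symmetric]
      by (simp add: case_prod_unfold monom_at_def prod.distrib mult.commute)
    then have "((\<lambda>\<beta>. monom_at v \<beta> *\<^sub>R recentre c w \<beta>) has_sum g (p + (w + v))) UNIV"
      by (rule has_sum_SigmaD) (rule inner)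
    then show ?thesis by (simp only: add.assoc)
  qed
  ultimately show ?thesis unfolding series_on_box_def by blast
qed

section \<open>Partial derivatives of a power series\<close>

definition unit_index :: "'n \<Rightarrow> 'n \<Rightarrow> nat" where
  "unit_index b i = (if i = b then 1 else 0)"

lemma unit_index_neq_zero: "unit_index b \<noteq> (\<lambda>i. 0)"
  by (metis unit_index_def one_neq_zero)

text \<open>On the axis only the multiples k of the unit index survive. Since k = 0 and k = 1 are
  excluded, |h|^k \<le> (h / r)^2 r^k.\<close>

lemma monom_at_axis_remainder:
  fixes \<beta> :: "'n::finite \<Rightarrow> nat"
  assumes "\<beta> \<noteq> (\<lambda>i. 0)" "\<beta> \<noteq> unit_index b" "\<bar>h\<bar> \<le> r" "r > 0"
  shows "\<bar>monom_at (h *\<^sub>R axis b 1) \<beta>\<bar> \<le> (h / r)\<^sup>2 * r ^ sum \<beta> UNIV"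
proof (cases "\<exists>i. i \<noteq> b \<and> \<beta> i \<noteq> 0")
  case True
  then have "monom_at (h *\<^sub>R axis b 1) \<beta> = 0"
    unfolding monom_at_def by (auto simp: axis_def intro!: prod_zero)
  then show ?thesis using assms by simp
next
  case False
  then have 0: "\<beta> i = 0" if "i \<noteq> b" for i using that by auto
  then have s: "sum \<beta> UNIV = \<beta> b"
    by (subst sum.remove[of _ b]) auto
  have "\<beta> b \<noteq> 0" using 0 assms(1) by (metis)
  moreover have "\<beta> b \<noteq> 1" using 0 assms(2) unfolding unit_index_def fun_eq_iff by metis
  ultimately have "\<beta> b \<ge> 2" by linarith
  then obtain k where k: "\<beta> b = 2 + k" using le_Suc_ex by blast
  have "monom_at (h *\<^sub>R axis b 1) \<beta> = h ^ \<beta> b"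
    unfolding monom_at_def using 0 by (subst prod.remove[of _ b]) (auto simp: axis_def)
  moreover have "\<bar>h ^ \<beta> b\<bar> \<le> h\<^sup>2 * r ^ k"
    unfolding k power_add abs_mult using assms(3,4) by (auto simp: power_abs intro!: mult_mono power_mono)
  moreover have "(h / r)\<^sup>2 * r ^ sum \<beta> UNIV = h\<^sup>2 * r ^ k"
    unfolding s k power_add using assms(4) by (simp add: power_divide)
  ultimately show ?thesis by simp
qed

lemma has_vector_derivative_at_0_quadratic:
  fixes F :: "real \<Rightarrow> 'v::real_normed_vector"
  assumes "\<And>h. \<bar>h\<bar> \<le> r \<Longrightarrow> norm (F h - F 0 - h *\<^sub>R D) \<le> C * h\<^sup>2" "r > 0"
  shows "(F has_vector_derivative D) (at 0)"
  unfolding has_vector_derivative_def has_derivative_at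
proof (intro conjI bounded_linear_scaleR_left)
  have ev: "eventually (\<lambda>h. \<bar>h\<bar> \<le> r) (at 0)"
    using assms(2) by (auto simp: eventually_at intro!: exI[of _ r])
  show "((\<lambda>h. norm (F (0 + h) - F 0 - h *\<^sub>R D) / norm h) \<longlongrightarrow> 0) (at 0)"
  proof (rule Lim_null_comparison)
    show "eventually (\<lambda>h. norm (norm (F (0 + h) - F 0 - h *\<^sub>R D) / norm h) \<le> C * \<bar>h\<bar>) (at 0)"
      using ev
    proof eventually_elim
      case (elim h)
      then show ?case using assms(1)[of h]
        by (cases "h = 0") (auto simp: field_simps power2_eq_square abs_mult)
    qed
    show "((\<lambda>h. C * \<bar>h\<bar>) \<longlongrightarrow> 0) (at 0)" by (auto intro!: tendsto_eq_intros)
  qed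
qed

text \<open>On an axis the series differs from its constant and linear terms by at most (h / r)^2 N.
  The case h = 0 gives the value, and the quadratic bound gives the derivative.\<close>

lemma series_on_box_centre:
  fixes c :: "('n::finite \<Rightarrow> nat) \<Rightarrow> 'v::banach"
  assumes "series_on_box c r N g p" "r > 0"
  shows "g p = c (\<lambda>i. 0)" and "partial_deriv b g p = c (unit_index b)"
proof -
  have c: "norm_sum_le (\<lambda>\<alpha>. r ^ sum \<alpha> UNIV *\<^sub>R c \<alpha>) UNIV N"
    using assms(1) by (simp add: series_on_box_def)
  have *: "norm (g (p + h *\<^sub>R axis b 1) - c (\<lambda>i. 0) - h *\<^sub>R c (unit_index b)) \<le> (N / r\<^sup>2) * h\<^sup>2"
    if h: "\<bar>h\<bar> \<le> r" for h b
  proof -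
    let ?v = "h *\<^sub>R axis b (1::real)" and ?X = "{\<lambda>i. 0, unit_index b}"
    have "\<bar>?v $ i\<bar> \<le> r" for i using h assms(2) by (auto simp: axis_def)
    then have "((\<lambda>\<alpha>. monom_at ?v \<alpha> *\<^sub>R c \<alpha>) has_sum g (p + ?v)) UNIV"
      using assms(1) unfolding series_on_box_def by blast
    moreover have "((\<lambda>\<alpha>. monom_at ?v \<alpha> *\<^sub>R c \<alpha>) has_sum (c (\<lambda>i. 0) + h *\<^sub>R c (unit_index b))) ?X"
    proof (rule has_sum_finiteI)
      have "monom_at ?v (unit_index b) = h"
        unfolding monom_at_def unit_index_def
        by (subst prod.remove[of _ b]) (auto simp: axis_def)
      moreover have "monom_at ?v (\<lambda>i. 0) = 1" by (simp add: monom_at_def)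
      ultimately show "c (\<lambda>i. 0) + h *\<^sub>R c (unit_index b) = (\<Sum>\<alpha>\<in>?X. monom_at ?v \<alpha> *\<^sub>R c \<alpha>)"
        using unit_index_neq_zero[of b] by simp
    qed simp
    ultimately have 1: "((\<lambda>\<alpha>. monom_at ?v \<alpha> *\<^sub>R c \<alpha>) has_sum
        (g (p + ?v) - (c (\<lambda>i. 0) + h *\<^sub>R c (unit_index b)))) (UNIV - ?X)"
      by (rule has_sum_Diff) simp
    have 2: "((\<lambda>\<alpha>. (h / r)\<^sup>2 * norm (r ^ sum \<alpha> UNIV *\<^sub>R c \<alpha>)) has_sum
        ((h / r)\<^sup>2 * (\<Sum>\<^sub>\<infinity>\<alpha>\<in>UNIV - ?X. norm (r ^ sum \<alpha> UNIV *\<^sub>R c \<alpha>)))) (UNIV - ?X)"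
      by (intro has_sum_cmult_right has_sum_infsum norm_sum_le_abs_summable[OF norm_sum_le_subset[OF c]]) blast
    have "norm (g (p + ?v) - (c (\<lambda>i. 0) + h *\<^sub>R c (unit_index b)))
        \<le> (h / r)\<^sup>2 * (\<Sum>\<^sub>\<infinity>\<alpha>\<in>UNIV - ?X. norm (r ^ sum \<alpha> UNIV *\<^sub>R c \<alpha>))"
    proof (rule norm_infsum_le[OF 1 2])
      fix \<alpha> assume "\<alpha> \<in> UNIV - ?X"
      then have "\<bar>monom_at ?v \<alpha>\<bar> \<le> (h / r)\<^sup>2 * r ^ sum \<alpha> UNIV"
        using monom_at_axis_remainder[OF _ _ h assms(2)] by auto
      from mult_right_mono[OF this, of "norm (c \<alpha>)"]
      show "norm (monom_at ?v \<alpha> *\<^sub>R c \<alpha>) \<le> (h / r)\<^sup>2 * norm (r ^ sum \<alpha> UNIV *\<^sub>R c \<alpha>)"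
        using assms(2) by (simp add: mult.assoc)
    qed
    also have "\<dots> \<le> (h / r)\<^sup>2 * N"
      using norm_sum_le_subset[OF c] by (intro mult_left_mono) (auto simp: norm_sum_le_def)
    finally show ?thesis by (simp add: diff_diff_eq power_divide mult.commute)
  qed
  show 0: "g p = c (\<lambda>i. 0)" using *[of 0] assms(2) by simp
  have "((\<lambda>h. g (p + h *\<^sub>R axis b 1)) has_vector_derivative c (unit_index b)) (at 0)"
    by (rule has_vector_derivative_at_0_quadratic[OF _ assms(2), where C = "N / r\<^sup>2"]) (use * 0 in simp)
  then show "partial_deriv b g p = c (unit_index b)"
    unfolding partial_deriv_def by (rule vector_derivative_at)
qed

text \<open>Formal termwise differentiation with respect to the b-th coordinate.\<close>

definition shift_coeff :: "'n \<Rightarrow> (('n \<Rightarrow> nat) \<Rightarrow> 'v::real_vector) \<Rightarrow> ('n \<Rightarrow> nat) \<Rightarrow> 'v" where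
  "shift_coeff b c \<gamma> = real (Suc (\<gamma> b)) *\<^sub>R c (\<gamma>(b := Suc (\<gamma> b)))"

lemma shift_coeff_binomial:
  fixes \<gamma> :: "'n::finite \<Rightarrow> nat"
  shows "(\<Prod>i\<in>UNIV. real (\<gamma> i + unit_index b i choose unit_index b i) * (w $ i) ^ \<gamma> i) *\<^sub>R
           c (\<lambda>i. \<gamma> i + unit_index b i) = monom_at w \<gamma> *\<^sub>R shift_coeff b c \<gamma>"
proof -
  have "(\<Prod>i\<in>UNIV. real (\<gamma> i + unit_index b i choose unit_index b i)) = real (Suc (\<gamma> b))"
    by (subst prod.remove[of _ b]) (auto simp: unit_index_def intro!: prod.neutral)
  moreover have "(\<lambda>i. \<gamma> i + unit_index b i) = \<gamma>(b := Suc (\<gamma> b))"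
    by (auto simp: unit_index_def)
  ultimately show ?thesis
    unfolding shift_coeff_def monom_at_def prod.distrib by (simp add: mult.commute)
qed

text \<open>The derivative at p + w is the linear coefficient of the series recentred there.
  Recentring needs the gap r - \<rho>, which is why radius is lost.\<close>

lemma series_on_box_partial_deriv:
  fixes c :: "('n::finite \<Rightarrow> nat) \<Rightarrow> 'v::banach"
  assumes "series_on_box c r N g p" "0 < \<rho>" "\<rho> < r"
  shows "\<exists>N'. series_on_box (shift_coeff b c) \<rho> N' (partial_deriv b g) p"
proof -
  have c: "norm_sum_le (\<lambda>\<alpha>. r ^ sum \<alpha> UNIV *\<^sub>R c \<alpha>) UNIV N"
    using assms(1) by (simp add: series_on_box_def)
  have "\<bar>(\<chi> i. \<rho>) $ i\<bar> + (r - \<rho>) \<le> r" for i :: 'n using assms by simp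
  moreover have "r - \<rho> > 0" using assms(3) by simp
  ultimately have "(\<lambda>\<alpha>. monom_at (\<chi> i. \<rho>) \<alpha> *\<^sub>R shift_coeff b c \<alpha>) abs_summable_on UNIV"
    by (rule recentre_has_sum(1)[OF c, where \<beta> = "unit_index b", unfolded shift_coeff_binomial])
  then have "(\<lambda>\<alpha>. \<rho> ^ sum \<alpha> UNIV *\<^sub>R shift_coeff b c \<alpha>) abs_summable_on UNIV"
    unfolding monom_at_const .
  then obtain N' where "norm_sum_le (\<lambda>\<alpha>. \<rho> ^ sum \<alpha> UNIV *\<^sub>R shift_coeff b c \<alpha>) UNIV N'"
    unfolding norm_sum_le_def by blast
  moreover have "((\<lambda>\<alpha>. monom_at w \<alpha> *\<^sub>R shift_coeff b c \<alpha>) has_sum partial_deriv b g (p + w)) UNIV"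
    if w: "\<forall>i. \<bar>w $ i\<bar> \<le> \<rho>" for w
  proof -
    have le: "\<bar>w $ i\<bar> + (r - \<rho>) \<le> r" for i using w by simp
    have pos: "r - \<rho> > 0" using assms by simp
    have "partial_deriv b g (p + w) = recentre c w (unit_index b)"
      by (rule series_on_box_centre(2)[OF series_on_box_recentre[OF assms(1) le pos] pos])
    then show ?thesis
      using recentre_has_sum(2)[OF c le pos, of "unit_index b"] by (simp only: shift_coeff_binomial)
  qed
  ultimately show ?thesis unfolding series_on_box_def by blast
qed

lemma series_on_box_shrink:
  fixes c :: "('n::finite \<Rightarrow> nat) \<Rightarrow> 'v::banach"
  assumes "series_on_box c r N g p" "0 \<le> \<rho>" "\<rho> \<le> r"
  shows "series_on_box c \<rho> N g p"
proof -
  have "norm_sum_le (\<lambda>\<alpha>. \<rho> ^ sum \<alpha> UNIV *\<^sub>R c \<alpha>) UNIV N"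
    by (rule norm_sum_le_comparison[of "\<lambda>\<alpha>. r ^ sum \<alpha> UNIV *\<^sub>R c \<alpha>"])
      (use assms in \<open>auto simp: series_on_box_def intro!: mult_right_mono power_mono\<close>)
  moreover have "\<forall>w. (\<forall>i. \<bar>w $ i\<bar> \<le> \<rho>) \<longrightarrow> (\<forall>i. \<bar>w $ i\<bar> \<le> r)"
    using assms(3) order_trans by blast
  ultimately show ?thesis using assms(1) unfolding series_on_box_def by blast
qed

text \<open>Since every derivative uses up some radius, the claim is made for all \<rho> < r; this
  leaves room for an intermediate radius in each step.\<close>

lemma series_on_box_iterated_partial_deriv:
  fixes c :: "('n::finite \<Rightarrow> nat) \<Rightarrow> 'v::banach"
  assumes "series_on_box c r N g p" "0 < \<rho>" "\<rho> < r"
  shows "\<exists>N'. series_on_box (foldr shift_coeff bs c) \<rho> N' (foldr partial_deriv bs g) p"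
  using assms(2,3)
proof (induction bs arbitrary: \<rho>)
  case Nil
  then show ?case using series_on_box_shrink[OF assms(1), of \<rho>] by auto
next
  case (Cons b bs)
  obtain \<rho>' where "\<rho> < \<rho>'" "\<rho>' < r" using dense[OF Cons.prems(2)] by blast
  have "0 < \<rho>'" using \<open>0 < \<rho>\<close> \<open>\<rho> < \<rho>'\<close> by simp
  from Cons.IH[OF this \<open>\<rho>' < r\<close>]
  obtain N' where "series_on_box (foldr shift_coeff bs c) \<rho>' N' (foldr partial_deriv bs g) p" ..
  from series_on_box_partial_deriv[OF this \<open>0 < \<rho>\<close> \<open>\<rho> < \<rho>'\<close>]
  show ?case unfolding foldr.simps o_apply .
qed

text \<open>The right-hand side sees bs only through its letter counts. This is how the partial
  derivatives turn out to commute.\<close>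

lemma foldr_shift_coeff:
  fixes c :: "('n::finite \<Rightarrow> nat) \<Rightarrow> 'v::real_vector"
  shows "foldr shift_coeff bs c \<gamma> =
    (\<Prod>i\<in>UNIV. fact (\<gamma> i + count_list bs i) / fact (\<gamma> i)) *\<^sub>R c (\<lambda>i. \<gamma> i + count_list bs i)"
proof (induction bs arbitrary: \<gamma>)
  case Nil
  then show ?case by simp
next
  case (Cons b bs)
  let ?\<gamma> = "\<gamma>(b := Suc (\<gamma> b))"
  have 1: "(\<lambda>i. ?\<gamma> i + count_list bs i) = (\<lambda>i. \<gamma> i + count_list (b # bs) i)" by auto
  have "(fact (?\<gamma> i + count_list bs i) / fact (?\<gamma> i) :: real) * (if i = b then real (Suc (\<gamma> b)) else 1)
      = fact (\<gamma> i + count_list (b # bs) i) / fact (\<gamma> i)" for i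
    by (simp add: field_simps)
  then have "(\<Prod>i\<in>UNIV. (fact (?\<gamma> i + count_list bs i) / fact (?\<gamma> i) :: real)) *
      (\<Prod>i\<in>UNIV. if i = b then real (Suc (\<gamma> b)) else 1)
      = (\<Prod>i\<in>UNIV. fact (\<gamma> i + count_list (b # bs) i) / fact (\<gamma> i))"
    unfolding prod.distrib[symmetric] by simp
  then have "real (Suc (\<gamma> b)) * (\<Prod>i\<in>UNIV. (fact (?\<gamma> i + count_list bs i) / fact (?\<gamma> i) :: real))
      = (\<Prod>i\<in>UNIV. fact (\<gamma> i + count_list (b # bs) i) / fact (\<gamma> i))"
    by (simp add: mult.commute)
  then show ?case
    unfolding foldr.simps o_apply shift_coeff_def[of b] Cons.IH 1 scaleR_scaleR by simp
qed

lemma iterated_partial_deriv_centre: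
  fixes c :: "('n::finite \<Rightarrow> nat) \<Rightarrow> 'v::banach"
  assumes "series_on_box c r N g p" "r > 0"
  shows "foldr partial_deriv bs g p = (\<Prod>i\<in>UNIV. fact (count_list bs i)) *\<^sub>R c (count_list bs)"
proof -
  obtain \<rho> where \<rho>: "0 < \<rho>" "\<rho> < r" using dense[OF assms(2)] by blast
  obtain N' where "series_on_box (foldr shift_coeff bs c) \<rho> N' (foldr partial_deriv bs g) p"
    using series_on_box_iterated_partial_deriv[OF assms(1) \<rho>] ..
  then have "foldr partial_deriv bs g p = foldr shift_coeff bs c (\<lambda>i. 0)"
    by (rule series_on_box_centre(1)[OF _ \<rho>(1)])
  then show ?thesis by (simp add: foldr_shift_coeff)
qed

section \<open>Taylor series over words of coordinates\<close>

text \<open>The words with letter counts \<alpha> are the rearrangements of a multiset with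
  multiplicities \<alpha>; their number is the multinomial coefficient |\<alpha>|! /
  \<alpha>!.\<close>

lemma count_list_fibre:
  fixes \<alpha> :: "'n::finite \<Rightarrow> nat"
  shows "finite {bs. count_list bs = \<alpha>}"
    and "real (card {bs. count_list bs = \<alpha>}) * (\<Prod>i\<in>UNIV. fact (\<alpha> i)) = fact (sum \<alpha> UNIV)"
proof -
  define M where "M = Abs_multiset \<alpha>"
  have M: "count M = \<alpha>" unfolding M_def by (rule count_Abs_multiset) simp
  have *: "{bs. count_list bs = \<alpha>} = permutations_of_multiset M"
    by (auto simp: permutations_of_multiset_def multiset_eq_iff fun_eq_iff count_mset M)
  then show "finite {bs. count_list bs = \<alpha>}" by simp
  have "(\<Prod>i\<in>UNIV. fact (\<alpha> i)) = (\<Prod>x\<in>set_mset M. fact (count M x) :: nat)"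
    by (rule prod.mono_neutral_cong_right) (auto simp: M count_eq_zero_iff[symmetric])
  moreover have "sum \<alpha> UNIV = size M"
    unfolding size_multiset_overloaded_eq
    by (rule sum.mono_neutral_cong_right) (auto simp: M count_eq_zero_iff[symmetric])
  ultimately have "card {bs. count_list bs = \<alpha>} * (\<Prod>i\<in>UNIV. fact (\<alpha> i)) = fact (sum \<alpha> UNIV)"
    using card_permutations_of_multiset_aux[of M] * by simp
  from arg_cong[OF this, of real]
  show "real (card {bs. count_list bs = \<alpha>}) * (\<Prod>i\<in>UNIV. fact (\<alpha> i)) = fact (sum \<alpha> UNIV)"
    by (simp only: of_nat_mult of_nat_prod of_nat_fact)
qed

lemma sum_count_list_UNIV: "sum (count_list bs) (UNIV :: 'n::finite set) = length bs"
proof (induction bs)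
  case (Cons b bs)
  have "count_list (b # bs) = (\<lambda>i. (if i = b then 1 else 0) + count_list bs i)" by auto
  then show ?case using Cons by (simp add: sum.distrib del: count_list.simps)
qed simp

lemma prod_list_eq_monom_at:
  fixes v :: "real ^ 'n::finite"
  shows "(\<Prod>b\<leftarrow>bs. v $ b) = monom_at v (count_list bs)"
proof (induction bs)
  case (Cons b bs)
  have "monom_at v (count_list (b # bs)) = (\<Prod>i\<in>UNIV. (if i = b then v $ b else 1) * (v $ i) ^ count_list bs i)"
    unfolding monom_at_def by (rule prod.cong) auto
  also have "\<dots> = v $ b * monom_at v (count_list bs)"
    unfolding prod.distrib monom_at_def by simp
  finally show ?case using Cons by (simp del: count_list.simps)
qed (simp add: monom_at_def)

text \<open>Words match the sum over b_1, ..., b_k in \<open>derivative_sum\<close>; 1 / k! is the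
  usual factor of the k-th derivative as a multilinear form.\<close>

definition taylor_coeff :: "(real ^ 'n \<Rightarrow> 'v::real_normed_vector) \<Rightarrow> real ^ 'n \<Rightarrow> 'n list \<Rightarrow> 'v" where
  "taylor_coeff g p bs = (1 / fact (length bs)) *\<^sub>R foldr partial_deriv bs g p"

text \<open>\<alpha>! / k! is the reciprocal of the number of words with counts \<alpha>, so c
  \<alpha> is split equally among these words.\<close>

lemma taylor_coeff_eq:
  fixes c :: "('n::finite \<Rightarrow> nat) \<Rightarrow> 'v::banach"
  assumes "series_on_box c r N g p" "r > 0"
  shows "taylor_coeff g p bs = (1 / real (card {bs'. count_list bs' = count_list bs})) *\<^sub>R c (count_list bs)"
proof -
  let ?P = "\<Prod>i\<in>UNIV. fact (count_list bs i) :: real"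
  have P: "?P \<noteq> 0" by simp
  have "fact (length bs) = real (card {bs'. count_list bs' = count_list bs}) * ?P"
    using count_list_fibre(2)[of "count_list bs"] by (simp add: sum_count_list_UNIV)
  then have "?P / fact (length bs) = 1 / real (card {bs'. count_list bs' = count_list bs})"
    using P by simp
  then show ?thesis
    unfolding taylor_coeff_def iterated_partial_deriv_centre[OF assms] by simp
qed

lemma taylor_coeff_mset_cong:
  fixes c :: "('n::finite \<Rightarrow> nat) \<Rightarrow> 'v::banach"
  assumes "series_on_box c r N g p" "r > 0" "mset bs = mset bs'"
  shows "taylor_coeff g p bs = taylor_coeff g p bs'"
proof -
  have "count_list bs = count_list bs'"
    by (rule ext) (simp only: count_mset[symmetric] assms(3))
  then show ?thesis by (simp only: taylor_coeff_eq[OF assms(1,2)])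
qed

text \<open>Equal shares of one vector have the same total norm as the vector itself, so passing
  from multi-indices to words keeps both r and N.\<close>

lemma series_on_box_taylor:
  fixes c :: "('n::finite \<Rightarrow> nat) \<Rightarrow> 'v::banach"
  assumes "series_on_box c r N g p" "r > 0"
  shows "norm_sum_le (\<lambda>bs. r ^ length bs *\<^sub>R taylor_coeff g p bs) UNIV N"
    and "(\<And>i. \<bar>v $ i\<bar> \<le> r) \<Longrightarrow> ((\<lambda>bs. (\<Prod>b\<leftarrow>bs. v $ b) *\<^sub>R taylor_coeff g p bs) has_sum g (p + v)) UNIV"
proof -
  let ?fib = "\<lambda>\<alpha>. {bs. count_list bs = (\<alpha> :: 'n \<Rightarrow> nat)}"
  have ne: "card (?fib \<alpha>) \<noteq> 0" for \<alpha>
  proof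
    assume "card (?fib \<alpha>) = 0"
    then have "fact (sum \<alpha> UNIV) = (0 :: real)" unfolding count_list_fibre(2)[symmetric] by simp
    then show False by simp
  qed
  have bij: "bij_betw snd (SIGMA \<alpha>:UNIV. ?fib \<alpha>) UNIV"
    by (rule bij_betwI[where g = "\<lambda>bs. (count_list bs, bs)"]) auto
  let ?K = "\<lambda>v bs. (\<Prod>b\<leftarrow>bs. v $ b) *\<^sub>R taylor_coeff g p bs"
  have K: "?K v bs = (1 / real (card (?fib \<alpha>))) *\<^sub>R (monom_at v \<alpha> *\<^sub>R c \<alpha>)"
    if "bs \<in> ?fib \<alpha>" for bs \<alpha> v
    using that unfolding prod_list_eq_monom_at taylor_coeff_eq[OF assms]
    by (auto simp: mult.commute)
  have inner: "((\<lambda>bs. ?K v (snd (\<alpha>, bs))) has_sum monom_at v \<alpha> *\<^sub>R c \<alpha>) (?fib \<alpha>)" for v \<alpha>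
  proof (rule has_sum_finiteI[OF count_list_fibre(1)])
    have "(\<Sum>bs\<in>?fib \<alpha>. ?K v (snd (\<alpha>, bs))) =
        (\<Sum>bs\<in>?fib \<alpha>. (1 / real (card (?fib \<alpha>))) *\<^sub>R (monom_at v \<alpha> *\<^sub>R c \<alpha>))"
      using K by (intro sum.cong) auto
    then show "monom_at v \<alpha> *\<^sub>R c \<alpha> = (\<Sum>bs\<in>?fib \<alpha>. ?K v (snd (\<alpha>, bs)))"
      using ne by (simp add: sum_constant_scaleR)
  qed
  have inner_norm: "((\<lambda>bs. norm (?K v (snd (\<alpha>, bs)))) has_sum norm (monom_at v \<alpha> *\<^sub>R c \<alpha>)) (?fib \<alpha>)" for v \<alpha>
  proof (rule has_sum_finiteI[OF count_list_fibre(1)])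
    have "(\<Sum>bs\<in>?fib \<alpha>. norm (?K v (snd (\<alpha>, bs)))) =
        (\<Sum>bs\<in>?fib \<alpha>. norm ((1 / real (card (?fib \<alpha>))) *\<^sub>R (monom_at v \<alpha> *\<^sub>R c \<alpha>)))"
      using K by (intro sum.cong) auto
    then show "norm (monom_at v \<alpha> *\<^sub>R c \<alpha>) = (\<Sum>bs\<in>?fib \<alpha>. norm (?K v (snd (\<alpha>, bs))))"
      using ne by simp
  qed
  have bound: "norm_sum_le (?K v) UNIV N" if "\<And>i. \<bar>v $ i\<bar> \<le> r" for v
  proof -
    have "norm_sum_le (\<lambda>\<alpha>. norm (monom_at v \<alpha> *\<^sub>R c \<alpha>)) UNIV N"
    proof (rule norm_sum_le_comparison)
      show "norm_sum_le (\<lambda>\<alpha>. r ^ sum \<alpha> UNIV *\<^sub>R c \<alpha>) UNIV N"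
        using assms(1) by (simp add: series_on_box_def)
      show "norm (norm (monom_at v \<alpha> *\<^sub>R c \<alpha>)) \<le> norm (r ^ sum \<alpha> UNIV *\<^sub>R c \<alpha>)" for \<alpha>
        using abs_monom_at_le[of v r \<alpha>] that assms(2) by (simp add: mult_right_mono)
    qed
    then have "norm_sum_le (\<lambda>p. ?K v (snd p)) (SIGMA \<alpha>:UNIV. ?fib \<alpha>) N"
      by (rule norm_sum_le_Sigma[rotated]) (rule inner_norm)
    then show ?thesis by (rule norm_sum_le_reindex[OF bij, THEN iffD1])
  qed
  have "?K (\<chi> i. r) bs = r ^ length bs *\<^sub>R taylor_coeff g p bs" for bs
    unfolding prod_list_eq_monom_at by (simp add: sum_count_list_UNIV)
  moreover have "norm_sum_le (?K (\<chi> i. r)) UNIV N" by (rule bound) (use assms(2) in simp)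
  ultimately show "norm_sum_le (\<lambda>bs. r ^ length bs *\<^sub>R taylor_coeff g p bs) UNIV N" by (simp only:)
  assume v: "\<And>i. \<bar>v $ i\<bar> \<le> r"
  have "((\<lambda>\<alpha>. monom_at v \<alpha> *\<^sub>R c \<alpha>) has_sum g (p + v)) UNIV"
    using assms(1) v by (simp add: series_on_box_def)
  moreover have "(\<lambda>p. ?K v (snd p)) summable_on (SIGMA \<alpha>:UNIV. ?fib \<alpha>)"
    by (rule summable_on_reindex_bij_betw[OF bij, THEN iffD2]) (rule norm_sum_le_summable[OF bound[OF v]])
  ultimately have "((\<lambda>p. ?K v (snd p)) has_sum g (p + v)) (SIGMA \<alpha>:UNIV. ?fib \<alpha>)"
    by (intro has_sum_SigmaI[OF inner])
  then show "(?K v has_sum g (p + v)) UNIV"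
    by (rule has_sum_reindex_bij_betw[OF bij, THEN iffD1])
qed

section \<open>Vector-valued series and a radius common to nearby base points\<close>

lemma has_sum_vec:
  fixes f :: "'a \<Rightarrow> real ^ 'n"
  assumes "\<And>i. ((\<lambda>x. f x $ i) has_sum s $ i) A"
  shows "(f has_sum s) A"
  unfolding has_sum_def
proof (rule vec_tendstoI)
  show "((\<lambda>X. sum f X $ i) \<longlongrightarrow> s $ i) (finite_subsets_at_top A)" for i
    using assms[of i] unfolding has_sum_def by (simp add: sum_component)
qed

lemma summable_on_finite_sum:
  fixes f :: "'i \<Rightarrow> 'a \<Rightarrow> 'b::{topological_comm_monoid_add}"
  assumes "finite I" "\<And>i. f i summable_on A"
  shows "(\<lambda>x. \<Sum>i\<in>I. f i x) summable_on A"
  using assms(1) by induction (simp_all add: summable_on_add assms(2))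

text \<open>The l1 estimate puts the box inside the Euclidean ball as soon as
  \<open>CARD('n) * r < R\<close>. Absolute summability at the corner holds because unconditional
  convergence of a real series is absolute.\<close>

lemma series_on_box_of_coordinates:
  fixes g :: "real ^ 'n \<Rightarrow> real ^ 'm"
  assumes "\<And>i. power_series_on_ball (\<lambda>\<xi>. g \<xi> $ i) p R" "r \<ge> 0" "real CARD('n) * r < R"
  shows "\<exists>c N. series_on_box c r N g p"
proof -
  have "\<forall>i. \<exists>c :: ('n \<Rightarrow> nat) \<Rightarrow> real. \<forall>\<xi>\<in>ball p R.
        ((\<lambda>\<alpha>. c \<alpha> * (\<Prod>j\<in>UNIV. ((\<xi> - p) $ j) ^ \<alpha> j)) has_sum g \<xi> $ i) UNIV"
    using assms(1) unfolding power_series_on_ball_def by blast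
  from choice[OF this] obtain c :: "'m \<Rightarrow> ('n \<Rightarrow> nat) \<Rightarrow> real" where c: "\<And>i \<xi>. \<xi> \<in> ball p R \<Longrightarrow>
        ((\<lambda>\<alpha>. c i \<alpha> * (\<Prod>j\<in>UNIV. ((\<xi> - p) $ j) ^ \<alpha> j)) has_sum g \<xi> $ i) UNIV"
    by blast
  define C where "C \<alpha> = (\<chi> i. c i \<alpha>)" for \<alpha>
  have hs: "((\<lambda>\<alpha>. monom_at w \<alpha> * c i \<alpha>) has_sum g (p + w) $ i) UNIV" if "\<forall>i. \<bar>w $ i\<bar> \<le> r" for w i
  proof -
    have "norm w \<le> (\<Sum>j\<in>UNIV. \<bar>w $ j\<bar>)" by (rule norm_le_l1_cart)
    also have "\<dots> \<le> real CARD('n) * r"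
      by (rule sum_bounded_above) (use that in auto)
    finally have "p + w \<in> ball p R" using assms(3) by (simp add: dist_norm)
    from c[OF this] show ?thesis by (simp add: monom_at_def mult.commute)
  qed
  have "((\<lambda>\<alpha>. monom_at w \<alpha> *\<^sub>R C \<alpha>) has_sum g (p + w)) UNIV" if "\<forall>i. \<bar>w $ i\<bar> \<le> r" for w
    by (rule has_sum_vec) (use hs[OF that] in \<open>simp add: C_def\<close>)
  moreover have "(\<lambda>\<alpha>. r ^ sum \<alpha> UNIV *\<^sub>R C \<alpha>) abs_summable_on UNIV"
  proof (rule Infinite_Sum.abs_summable_on_comparison_test')
    have "(\<lambda>\<alpha>. r ^ sum \<alpha> UNIV * c i \<alpha>) summable_on UNIV" for i
      using has_sum_imp_summable[OF hs[of "\<chi> i. r" i]] assms(2) by simp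
    then have "(\<lambda>\<alpha>. \<bar>r ^ sum \<alpha> UNIV * c i \<alpha>\<bar>) summable_on UNIV" for i
      by (rule summable_on_iff_abs_summable_on_real[THEN iffD1, unfolded real_norm_def])
    then show "(\<lambda>\<alpha>. \<Sum>i\<in>UNIV. \<bar>r ^ sum \<alpha> UNIV * c i \<alpha>\<bar>) summable_on UNIV"
      by (rule summable_on_finite_sum[OF finite])
    show "norm (r ^ sum \<alpha> UNIV *\<^sub>R C \<alpha>) \<le> (\<Sum>i\<in>UNIV. \<bar>r ^ sum \<alpha> UNIV * c i \<alpha>\<bar>)" for \<alpha>
      using norm_le_l1_cart[of "r ^ sum \<alpha> UNIV *\<^sub>R C \<alpha>"] by (simp add: C_def)
  qed
  ultimately have "series_on_box C r (\<Sum>\<^sub>\<infinity>\<alpha>. norm (r ^ sum \<alpha> UNIV *\<^sub>R C \<alpha>)) g p"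
    unfolding series_on_box_def norm_sum_le_def by simp
  then show ?thesis by blast
qed

lemma series_on_box_weaken: "series_on_box c r N g p \<Longrightarrow> N \<le> N' \<Longrightarrow> series_on_box c r N' g p"
  unfolding series_on_box_def using norm_sum_le_weaken by blast

lemma uniform_series_on_box:
  fixes f :: "'d::finite \<Rightarrow> real ^ 'n \<Rightarrow> real ^ 'm"
  assumes "\<And>a i. power_series_on_ball (\<lambda>\<xi>. f a \<xi> $ i) \<eta> R" "R > 0"
  shows "\<exists>\<rho> N. \<rho> > 0 \<and> N \<ge> 0 \<and> (\<forall>a \<xi>. norm (\<xi> - \<eta>) \<le> \<rho> \<longrightarrow> (\<exists>c. series_on_box c \<rho> N (f a) \<xi>))"
proof -
  \<comment> \<open>The factor 2 makes \<open>CARD('n) * r\<close> strictly smaller than R. Below,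
    one half of the box is spent on moving the centre and the other half remains as the
    radius.\<close>
  define r where "r = R / (2 * real CARD('n))"
  have "real CARD('n) * r = R / 2" by (simp add: r_def)
  then have "real CARD('n) * r < R" and r: "r > 0" using assms(2) by (auto simp: r_def)
  then have "\<forall>a. \<exists>c N. series_on_box c r N (f a) \<eta>"
    using series_on_box_of_coordinates[OF assms(1)] by simp
  then obtain c N where cN: "\<And>a. series_on_box (c a) r (N a) (f a) \<eta>" by metis
  then have N: "N a \<ge> 0" for a
    unfolding series_on_box_def using norm_sum_le_nonneg by blast
  have "\<exists>c. series_on_box c (r / 2) (sum N UNIV) (f a) \<xi>" if \<xi>: "norm (\<xi> - \<eta>) \<le> r / 2" for a \<xi>
  proof -
    have "\<bar>(\<xi> - \<eta>) $ i\<bar> + r / 2 \<le> r" for i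
      using component_le_norm_cart[of "\<xi> - \<eta>" i] \<xi> by linarith
    moreover have "r / 2 > 0" using r by simp
    ultimately have "series_on_box (recentre (c a) (\<xi> - \<eta>)) (r / 2) (N a) (f a) (\<eta> + (\<xi> - \<eta>))"
      by (rule series_on_box_recentre[OF cN])
    moreover have "N a \<le> sum N UNIV" by (rule member_le_sum) (use N in auto)
    ultimately have "series_on_box (recentre (c a) (\<xi> - \<eta>)) (r / 2) (sum N UNIV) (f a) \<xi>"
      by (simp add: series_on_box_weaken)
    then show ?thesis by blast
  qed
  moreover have "0 < r / 2" "0 \<le> sum N UNIV" using r N by (simp_all add: sum_nonneg)
  ultimately show ?thesis by blast
qed

section \<open>Sums over lists and multisets of branches\<close>

text \<open>With \<open>taylor_coeff g p\<close> for c and k vectors, this is the k-th derivative of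
  g at p divided by k!.\<close>

definition multilinear_form :: "('n list \<Rightarrow> 'v) \<Rightarrow> (real ^ 'n) list \<Rightarrow> 'v::real_normed_vector" where
  "multilinear_form c vs =
     (\<Sum>bs | length bs = length vs. (\<Prod>i<length vs. vs ! i $ bs ! i) *\<^sub>R c bs)"

lemma derivative_sum_eq_multilinear_form:
  "derivative_sum g \<xi> vs = fact (length vs) *\<^sub>R multilinear_form (taylor_coeff g \<xi>) vs"
  unfolding derivative_sum_def multilinear_form_def taylor_coeff_def scaleR_sum_right
  by (rule sum.cong) auto

text \<open>Permuting the vectors amounts to permuting the words, which only reindexes the sum when
  c ignores the order of letters. This makes the arbitrary enumeration in
  \<open>elementary_differential\<close> harmless.\<close>

lemma multilinear_form_mset_cong:
  fixes vs vs' :: "(real ^ 'n) list"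
  assumes "mset vs = mset vs'" "\<And>bs bs'. mset bs = mset bs' \<Longrightarrow> c bs = c bs'"
  shows "multilinear_form c vs = multilinear_form c vs'"
proof -
  from assms(1) obtain \<pi> where \<pi>: "\<pi> permutes {..<length vs'}" "permute_list \<pi> vs' = vs"
    by (rule mset_eq_permutation)
  let ?k = "length vs'" and ?L = "{bs :: 'n list. length bs = length vs'}"
  have len: "length vs = ?k" using assms(1) by (rule mset_eq_length)
  have bij: "bij_betw (permute_list \<pi>) ?L ?L"
  proof (rule bij_betwI[where g = "permute_list (inv \<pi>)"])
    fix bs :: "'n list" assume "bs \<in> ?L"
    then have \<pi>': "\<pi> permutes {..<length bs}" "inv \<pi> permutes {..<length bs}"
      using \<pi>(1) permutes_inv[OF \<pi>(1)] by auto
    show "permute_list (inv \<pi>) (permute_list \<pi> bs) = bs"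
      unfolding permute_list_compose[OF \<pi>'(2), symmetric] permutes_inv_o(1)[OF \<pi>(1)] by simp
    show "permute_list \<pi> (permute_list (inv \<pi>) bs) = bs"
      unfolding permute_list_compose[OF \<pi>'(1), symmetric] permutes_inv_o(2)[OF \<pi>(1)] by simp
  qed auto
  have "multilinear_form c vs = (\<Sum>bs\<in>?L. (\<Prod>i<?k. vs ! i $ bs ! i) *\<^sub>R c bs)"
    unfolding multilinear_form_def len ..
  also have "\<dots> = (\<Sum>bs\<in>?L. (\<Prod>i<?k. vs ! i $ permute_list \<pi> bs ! i) *\<^sub>R c (permute_list \<pi> bs))"
    by (rule sum.reindex_bij_betw[OF bij, symmetric])
  also have "\<dots> = (\<Sum>bs\<in>?L. (\<Prod>i<?k. vs' ! i $ bs ! i) *\<^sub>R c bs)"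
  proof (rule sum.cong)
    fix bs assume "bs \<in> ?L"
    then have l: "length bs = ?k" by simp
    have "(\<Prod>i<?k. vs ! i $ permute_list \<pi> bs ! i) = (\<Prod>i<?k. vs' ! \<pi> i $ bs ! \<pi> i)"
    proof (rule prod.cong)
      fix i assume "i \<in> {..<?k}"
      then have "vs ! i = vs' ! \<pi> i" "permute_list \<pi> bs ! i = bs ! \<pi> i"
        using permute_list_nth[OF \<pi>(1), of i] permute_list_nth[of \<pi> bs i] \<pi> l by auto
      then show "vs ! i $ permute_list \<pi> bs ! i = vs' ! \<pi> i $ bs ! \<pi> i" by simp
    qed simp
    also have "\<dots> = (\<Prod>i<?k. vs' ! i $ bs ! i)"
      using prod.permute[OF \<pi>(1), of "\<lambda>i. vs' ! i $ bs ! i"] by (simp add: o_def)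
    moreover have "c (permute_list \<pi> bs) = c bs"
      by (rule assms(2)) (use \<pi>(1) l in simp)
    ultimately show "(\<Prod>i<?k. vs ! i $ permute_list \<pi> bs ! i) *\<^sub>R c (permute_list \<pi> bs) =
        (\<Prod>i<?k. vs' ! i $ bs ! i) *\<^sub>R c bs" by simp
  qed simp
  finally show ?thesis unfolding multilinear_form_def .
qed

lemma multilinear_form_scale:
  "multilinear_form c (map (\<lambda>t. a t *\<^sub>R e t) ts) = (\<Prod>t\<leftarrow>ts. a t) *\<^sub>R multilinear_form c (map e ts)"
proof -
  have "(\<Prod>i<length ts. a (ts ! i)) = (\<Prod>t\<leftarrow>ts. a t)"
    by (simp add: prod.list_conv_set_nth atLeast0LessThan)
  then show ?thesis
    unfolding multilinear_form_def scaleR_sum_right by (intro sum.cong) (auto simp: prod.distrib)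
qed

lemma prod_nth_eq_map2:
  assumes "length bs = length ts"
  shows "(\<Prod>i<length ts. h (ts ! i) (bs ! i)) = prod_list (map2 h ts bs)"
  using assms by (simp add: prod.list_conv_set_nth atLeast0LessThan)

lemma norm_sum_le_infsum:
  assumes "norm_sum_le f A N"
  shows "(\<Sum>\<^sub>\<infinity>x\<in>A. norm (f x)) \<le> N" and "(\<Sum>\<^sub>\<infinity>x\<in>A. norm (f x)) \<ge> 0"
    and "((\<lambda>x. norm (f x)) has_sum (\<Sum>\<^sub>\<infinity>x\<in>A. norm (f x))) A"
  using assms by (simp_all add: norm_sum_le_def infsum_nonneg)

text \<open>A product of coordinate series, one factor for each letter of bs, is multiplied out over
  lists of indices. Bound and value share one induction: the bound justifies summing the product
  over pairs.\<close>

lemma coordinate_product_sum: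
  fixes u :: "'t \<Rightarrow> real ^ 'n"
  assumes "norm_sum_le u A S" "(u has_sum v) A"
  shows "norm_sum_le (\<lambda>ts. prod_list (map2 (\<lambda>t b. u t $ b) ts bs)) {ts \<in> lists A. length ts = length bs} (S ^ length bs)
       \<and> ((\<lambda>ts. prod_list (map2 (\<lambda>t b. u t $ b) ts bs)) has_sum (\<Prod>b\<leftarrow>bs. v $ b)) {ts \<in> lists A. length ts = length bs}"
proof (induction bs)
  case Nil
  have *: "{ts \<in> lists A. length ts = length []} = {[]}" by auto
  have "norm_sum_le (\<lambda>ts. prod_list (map2 (\<lambda>t b. u t $ b) ts [])) {[]} (S ^ length [])"
    by (rule norm_sum_leI[where S = 1]) (auto intro: has_sum_finiteI)
  moreover have "((\<lambda>ts. prod_list (map2 (\<lambda>t b. u t $ b) ts [])) has_sum (\<Prod>b\<leftarrow>[]. v $ b)) {[]}"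
    by (rule has_sum_finiteI) simp_all
  ultimately show ?case unfolding * by blast
next
  case (Cons b bs)
  let ?L = "\<lambda>bs :: 'n list. {ts \<in> lists A. length ts = length bs}"
  let ?P = "\<lambda>ts bs. prod_list (map2 (\<lambda>t b. u t $ b) ts bs)"
  have S: "S \<ge> 0" using assms(1) by (rule norm_sum_le_nonneg)
  have bij: "bij_betw (\<lambda>(t, ts). t # ts) (A \<times> ?L bs) (?L (b # bs))"
    by (rule bij_betwI[where g = "\<lambda>ts. (hd ts, tl ts)"]) (auto simp: length_Suc_conv)
  have P: "?P ((\<lambda>(t, ts). t # ts) p) (b # bs) = u (fst p) $ b * ?P (snd p) bs" for p
    by (simp add: case_prod_unfold)
  define Z where "Z = (\<Sum>\<^sub>\<infinity>ts\<in>?L bs. norm (?P ts bs))"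
  have P': "norm_sum_le (\<lambda>ts. ?P ts bs) (?L bs) (S ^ length bs)"
    and v: "((\<lambda>ts. ?P ts bs) has_sum (\<Prod>b\<leftarrow>bs. v $ b)) (?L bs)"
    using Cons by blast+
  have Z: "Z \<le> S ^ length bs" "Z \<ge> 0" "((\<lambda>ts. norm (?P ts bs)) has_sum Z) (?L bs)"
    unfolding Z_def by (rule norm_sum_le_infsum[OF P'])+
  have "norm_sum_le (\<lambda>t. norm (u t $ b) * Z) A (S * S ^ length bs)"
  proof -
    have "norm_sum_le (\<lambda>t. S ^ length bs *\<^sub>R u t) A (S * S ^ length bs)"
    proof (rule norm_sum_leI)
      show "((\<lambda>t. norm (S ^ length bs *\<^sub>R u t)) has_sum (S ^ length bs * (\<Sum>\<^sub>\<infinity>t\<in>A. norm (u t)))) A"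
        using has_sum_cmult_right[OF has_sum_infsum[OF norm_sum_le_abs_summable[OF assms(1)]], of "S ^ length bs"] S by simp
      show "S ^ length bs * (\<Sum>\<^sub>\<infinity>t\<in>A. norm (u t)) \<le> S * S ^ length bs"
        using mult_left_mono[OF norm_sum_le_infsum(1)[OF assms(1)], of "S ^ length bs"] S
        by (simp add: mult.commute)
    qed
    then show ?thesis
    proof (rule norm_sum_le_comparison)
      fix t
      have "norm (u t $ b) * Z \<le> norm (u t) * S ^ length bs"
        using Z S component_le_norm_cart[of "u t" b] by (intro mult_mono) auto
      then show "norm (norm (u t $ b) * Z) \<le> norm (S ^ length bs *\<^sub>R u t)"
        using Z S by (simp add: abs_mult mult.commute)
    qed
  qed
  then have 1: "norm_sum_le (\<lambda>p. u (fst p) $ b * ?P (snd p) bs) (A \<times> ?L bs) (S * S ^ length bs)"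
    by (rule norm_sum_le_Sigma[rotated]) (use has_sum_cmult_right[OF Z(3)] in \<open>simp add: abs_mult\<close>)
  have 2: "((\<lambda>p. u (fst p) $ b * ?P (snd p) bs) has_sum v $ b * (\<Prod>b\<leftarrow>bs. v $ b)) (A \<times> ?L bs)"
  proof (rule has_sum_SigmaI)
    show "((\<lambda>ts. u (fst (t, ts)) $ b * ?P (snd (t, ts)) bs) has_sum u t $ b * (\<Prod>b\<leftarrow>bs. v $ b)) (?L bs)" for t
      using has_sum_cmult_right[OF v] by simp
    have "((\<lambda>t. u t $ b) has_sum v $ b) A"
      using has_sum_bounded_linear[OF bounded_linear_vec_nth[of b] assms(2)] by (simp add: o_def)
    then show "((\<lambda>t. u t $ b * (\<Prod>b\<leftarrow>bs. v $ b)) has_sum v $ b * (\<Prod>b\<leftarrow>bs. v $ b)) A"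
      by (rule has_sum_cmult_left)
    show "(\<lambda>p. u (fst p) $ b * ?P (snd p) bs) summable_on A \<times> ?L bs"
      using 1 by (rule norm_sum_le_summable)
  qed
  have "norm_sum_le (\<lambda>ts. ?P ts (b # bs)) (?L (b # bs)) (S ^ length (b # bs))"
    using 1 unfolding norm_sum_le_reindex[OF bij, where f = "\<lambda>ts. ?P ts (b # bs)", symmetric] P by simp
  moreover have "((\<lambda>ts. ?P ts (b # bs)) has_sum (\<Prod>b\<leftarrow>b # bs. v $ b)) (?L (b # bs))"
    using 2 unfolding has_sum_reindex_bij_betw[OF bij, where f = "\<lambda>ts. ?P ts (b # bs)", symmetric] P by simp
  ultimately show ?case by blast
qed

text \<open>The pairs of a list ts and a word bs of equal length k form an absolutely summable
  family, the lists contributing at most S^k \<le> \<rho>^k for each word. Summed over ts first it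
  is the Taylor series at the increment v; summed over bs first it is a sum over lists.\<close>

lemma multilinear_form_sum_lists:
  fixes u :: "'t \<Rightarrow> real ^ 'n" and c :: "'n list \<Rightarrow> 'v::banach"
  assumes "norm_sum_le u A S" "S \<le> \<rho>" "norm_sum_le (\<lambda>bs. \<rho> ^ length bs *\<^sub>R c bs) UNIV N"
  shows "norm_sum_le (\<lambda>ts. multilinear_form c (map u ts)) (lists A) N"
    and "(u has_sum v) A \<Longrightarrow> ((\<lambda>bs. (\<Prod>b\<leftarrow>bs. v $ b) *\<^sub>R c bs) has_sum s) UNIV \<Longrightarrow>
           ((\<lambda>ts. multilinear_form c (map u ts)) has_sum s) (lists A)"
proof -
  let ?L = "\<lambda>bs :: 'n list. {ts \<in> lists A. length ts = length bs}"
  let ?P = "\<lambda>ts bs. prod_list (map2 (\<lambda>t b. u t $ b) ts bs)"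
  let ?H = "\<lambda>(ts, bs). ?P ts bs *\<^sub>R c bs"
  let ?D = "SIGMA bs:UNIV. ?L bs" and ?E = "SIGMA ts:lists A. {bs. length bs = length ts}"
  have S: "S \<ge> 0" using assms(1) by (rule norm_sum_le_nonneg)
  have bij: "bij_betw (\<lambda>(bs, ts). (ts, bs)) ?D ?E"
    by (rule bij_betwI[where g = "\<lambda>(ts, bs). (bs, ts)"]) auto
  obtain v0 where v0: "(u has_sum v0) A"
    using norm_sum_le_summable[OF assms(1)] unfolding summable_on_def by blast
  define Z where "Z bs = (\<Sum>\<^sub>\<infinity>ts\<in>?L bs. norm (?P ts bs))" for bs
  have Z: "Z bs \<le> S ^ length bs" "Z bs \<ge> 0" "((\<lambda>ts. norm (?P ts bs)) has_sum Z bs) (?L bs)" for bs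
    unfolding Z_def
    by (rule norm_sum_le_infsum[OF coordinate_product_sum[OF assms(1) v0, THEN conjunct1]])+
  have "norm_sum_le (\<lambda>bs. Z bs * norm (c bs)) UNIV N"
  proof (rule norm_sum_le_comparison[OF assms(3)])
    fix bs
    have "Z bs \<le> \<rho> ^ length bs"
      using Z(1)[of bs] power_mono[OF assms(2) S, of "length bs"] by linarith
    then have "Z bs * norm (c bs) \<le> \<rho> ^ length bs * norm (c bs)"
      by (rule mult_right_mono) simp
    then show "norm (Z bs * norm (c bs)) \<le> norm (\<rho> ^ length bs *\<^sub>R c bs)"
      using Z(2) S assms(2) by (simp add: abs_mult)
  qed
  then have D: "norm_sum_le (\<lambda>p. ?H ((\<lambda>(bs, ts). (ts, bs)) p)) ?D N"
    by (rule norm_sum_le_Sigma[rotated]) (use has_sum_cmult_left[OF Z(3)] in simp)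
  then have E: "norm_sum_le ?H ?E N"
    by (rule norm_sum_le_reindex[OF bij, THEN iffD1])
  have inner: "((\<lambda>bs. ?H (ts, bs)) has_sum multilinear_form c (map u ts)) {bs. length bs = length ts}" for ts
  proof (rule has_sum_finiteI)
    show "finite {bs :: 'n list. length bs = length ts}"
      using finite_lists_length_eq[of "UNIV :: 'n set"] by simp
    show "multilinear_form c (map u ts) = (\<Sum>bs | length bs = length ts. ?H (ts, bs))"
      unfolding multilinear_form_def length_map
      by (rule sum.cong) (auto simp: prod_nth_eq_map2[where h = "\<lambda>t b. u t $ b", symmetric])
  qed
  show "norm_sum_le (\<lambda>ts. multilinear_form c (map u ts)) (lists A) N"
    by (rule norm_sum_le_SigmaD[OF E inner])
  assume v: "(u has_sum v) A" and s: "((\<lambda>bs. (\<Prod>b\<leftarrow>bs. v $ b) *\<^sub>R c bs) has_sum s) UNIV"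
  have "((\<lambda>p. ?H ((\<lambda>(bs, ts). (ts, bs)) p)) has_sum s) ?D"
  proof (rule has_sum_SigmaI[OF _ s norm_sum_le_summable[OF D]])
    fix bs
    have "((\<lambda>ts. ?P ts bs) has_sum (\<Prod>b\<leftarrow>bs. v $ b)) (?L bs)"
      using coordinate_product_sum[OF assms(1) v] by blast
    from has_sum_bounded_linear[OF bounded_linear_scaleR_left this, of "c bs"]
    show "((\<lambda>ts. ?H ((\<lambda>(bs, ts). (ts, bs)) (bs, ts))) has_sum (\<Prod>b\<leftarrow>bs. v $ b) *\<^sub>R c bs) (?L bs)"
      by (simp add: o_def)
  qed
  then have "(?H has_sum s) ?E"
    by (rule has_sum_reindex_bij_betw[OF bij, THEN iffD1])
  then show "((\<lambda>ts. multilinear_form c (map u ts)) has_sum s) (lists A)"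
    by (rule has_sum_SigmaD[OF _ inner])
qed

text \<open>Each multiset collects its rearrangements; their number is the \<delta> of the symmetry
  factor.\<close>

lemma sum_lists_multisets:
  fixes F :: "'t multiset \<Rightarrow> 'v::banach"
  assumes "norm_sum_le (\<lambda>ts. F (mset ts)) (lists A) N"
  shows "norm_sum_le (\<lambda>M. real (card (permutations_of_multiset M)) *\<^sub>R F M) {M. set_mset M \<subseteq> A} N"
    and "((\<lambda>ts. F (mset ts)) has_sum s) (lists A) \<Longrightarrow>
      ((\<lambda>M. real (card (permutations_of_multiset M)) *\<^sub>R F M) has_sum s) {M. set_mset M \<subseteq> A}"
proof -
  have bij: "bij_betw snd (SIGMA M:{M. set_mset M \<subseteq> A}. permutations_of_multiset M) (lists A)"
    by (rule bij_betwI[where g = "\<lambda>ts. (mset ts, ts)"]) (auto simp: permutations_of_multiset_def)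
  have inner: "((\<lambda>ts. F (mset (snd (M, ts)))) has_sum real (card (permutations_of_multiset M)) *\<^sub>R F M)
      (permutations_of_multiset M)" for M
  proof (rule has_sum_finiteI)
    have "(\<Sum>ts\<in>permutations_of_multiset M. F (mset (snd (M, ts)))) = (\<Sum>ts\<in>permutations_of_multiset M. F M)"
      by (rule sum.cong) (auto simp: permutations_of_multiset_def)
    then show "real (card (permutations_of_multiset M)) *\<^sub>R F M = (\<Sum>ts\<in>permutations_of_multiset M. F (mset (snd (M, ts))))"
      by (simp add: sum_constant_scaleR)
  qed simp
  show "norm_sum_le (\<lambda>M. real (card (permutations_of_multiset M)) *\<^sub>R F M) {M. set_mset M \<subseteq> A} N"
    by (rule norm_sum_le_SigmaD[OF norm_sum_le_reindex[OF bij, THEN iffD2, OF assms] inner])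
  assume "((\<lambda>ts. F (mset ts)) has_sum s) (lists A)"
  then show "((\<lambda>M. real (card (permutations_of_multiset M)) *\<^sub>R F M) has_sum s) {M. set_mset M \<subseteq> A}"
    by (intro has_sum_SigmaD[OF has_sum_reindex_bij_betw[OF bij, THEN iffD2] inner])
qed

section \<open>Elementary differentials and the sum over the branches at a root\<close>

text \<open>Any enumeration ts may replace the one picked by \<open>SOME\<close>, because Taylor
  coefficients depend only on the multiset of letters. The factorial undoes the one in
  \<open>taylor_coeff\<close>.\<close>

lemma elementary_differential_Node:
  fixes f :: "'l \<Rightarrow> real ^ 'n \<Rightarrow> real ^ 'n"
  assumes "series_on_box c r N (f a) \<xi>" "r > 0"
  shows "elementary_differential f (Node a (mset ts)) \<xi> =
    fact (length ts) *\<^sub>R multilinear_form (taylor_coeff (f a) \<xi>) (map (\<lambda>\<tau>. elementary_differential f \<tau> \<xi>) ts)"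
proof -
  let ?\<phi>s = "SOME \<phi>s. mset \<phi>s = image_mset (elementary_differential f) (mset ts)"
  have \<phi>s: "mset ?\<phi>s = image_mset (elementary_differential f) (mset ts)"
    by (rule someI_ex) (metis mset_map)
  then have "mset (map (\<lambda>\<phi>. \<phi> \<xi>) ?\<phi>s) = mset (map (\<lambda>\<tau>. elementary_differential f \<tau> \<xi>) ts)"
    by (simp add: image_mset.compositionality o_def)
  then have "multilinear_form (taylor_coeff (f a) \<xi>) (map (\<lambda>\<phi>. \<phi> \<xi>) ?\<phi>s) =
      multilinear_form (taylor_coeff (f a) \<xi>) (map (\<lambda>\<tau>. elementary_differential f \<tau> \<xi>) ts)"
    by (rule multilinear_form_mset_cong) (rule taylor_coeff_mset_cong[OF assms])
  moreover have "length ?\<phi>s = length ts" using \<phi>s by (metis size_image_mset size_mset)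
  ultimately show ?thesis
    by (simp add: derivative_sum_eq_multilinear_form)
qed

lemma symmetry_factor_pos: "symmetry_factor \<tau> > 0"
proof (induction \<tau>)
  case (Node a \<tau>s)
  have "permutations_of_multiset \<tau>s \<noteq> {}" by (rule permutations_of_multiset_not_empty)
  then have "card (permutations_of_multiset \<tau>s) > 0" by (simp add: card_gt_0_iff)
  moreover have "(\<Prod>\<tau>\<in>#\<tau>s. symmetry_factor \<tau>) > 0"
    using Node by (induction \<tau>s) auto
  ultimately show ?case by simp
qed

lemma prod_mset_divide:
  fixes a b :: "'t \<Rightarrow> 'v::field"
  shows "(\<Prod>t\<in>#M. a t / b t) = (\<Prod>t\<in>#M. a t) / (\<Prod>t\<in>#M. b t)"
  by (induction M) simp_all

text \<open>Here the symmetry factors arise: a list of k branches carries the product of their 1 /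
  \<sigma> and a factor 1 / k!, and the \<delta> rearrangements of a multiset turn this into 1 /
  \<sigma> of the tree with root a. The family w has no factor for the root itself, just like the
  derivative of an iterated integral.\<close>

lemma branch_sum:
  fixes f :: "'l \<Rightarrow> real ^ 'n \<Rightarrow> real ^ 'n" and \<xi> :: "real ^ 'n" and a :: 'l and X :: "'l ltree \<Rightarrow> real"
  defines "u \<equiv> \<lambda>\<tau>. (X \<tau> / symmetry_factor \<tau>) *\<^sub>R elementary_differential f \<tau> \<xi>"
  defines "w \<equiv> \<lambda>M. ((\<Prod>\<tau>\<in>#M. X \<tau>) / symmetry_factor (Node a M)) *\<^sub>R elementary_differential f (Node a M) \<xi>"
  assumes "series_on_box c \<rho> N (f a) \<xi>" "\<rho> > 0" "norm_sum_le u A S" "S \<le> \<rho>"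
  shows "norm_sum_le w {M. set_mset M \<subseteq> A} N"
    and "(u has_sum v) A \<Longrightarrow> (w has_sum f a (\<xi> + v)) {M. set_mset M \<subseteq> A}"
proof -
  \<comment> \<open>The term of a single list with multiset M, before multiplication by the number
    of rearrangements.\<close>
  define F where "F M = ((\<Prod>\<tau>\<in>#M. X \<tau> / symmetry_factor \<tau>) / fact (size M)) *\<^sub>R elementary_differential f (Node a M) \<xi>" for M
  have F: "F (mset ts) = multilinear_form (taylor_coeff (f a) \<xi>) (map u ts)" for ts
    unfolding F_def u_def multilinear_form_scale elementary_differential_Node[where f = f and a = a, OF assms(3,4)]
    by (simp flip: prod_mset_prod_list mset_map)
  have w: "real (card (permutations_of_multiset M)) *\<^sub>R F M = w M" for M
    unfolding F_def w_def prod_mset_divide by (simp add: mult.commute)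
  note T = series_on_box_taylor[OF assms(3,4)]
  have L: "norm_sum_le (\<lambda>ts. F (mset ts)) (lists A) N"
    unfolding F by (rule multilinear_form_sum_lists(1)[OF assms(5,6) T(1)])
  from sum_lists_multisets(1)[OF L] show "norm_sum_le w {M. set_mset M \<subseteq> A} N" unfolding w .
  assume v: "(u has_sum v) A"
  have "\<bar>v $ i\<bar> \<le> \<rho>" for i
    using component_le_norm_cart[of v i] norm_sum_le_norm_has_sum[OF assms(5) v] assms(6) by linarith
  then have "((\<lambda>ts. F (mset ts)) has_sum f a (\<xi> + v)) (lists A)"
    unfolding F by (intro multilinear_form_sum_lists(2)[OF assms(5,6) T(1) v] T(2))
  from sum_lists_multisets(2)[OF L this] show "(w has_sum f a (\<xi> + v)) {M. set_mset M \<subseteq> A}" unfolding w .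
qed

section \<open>Iterated integrals\<close>

text \<open>This is h^n for a tree with n vertices; the product over the branches has the form in
  which \<open>branch_sum\<close> uses X.\<close>

primrec tree_weight :: "real \<Rightarrow> 'l ltree \<Rightarrow> real" where
  "tree_weight h (Node a \<tau>s) = h * (\<Prod>\<tau>\<in>#\<tau>s. tree_weight h \<tau>)"

lemma prod_mset_image_nonneg:
  fixes B :: "'i \<Rightarrow> real"
  shows "(\<And>i. i \<in># M \<Longrightarrow> B i \<ge> 0) \<Longrightarrow> (\<Prod>i\<in>#M. B i) \<ge> 0"
  by (induction M) auto

lemma tree_weight_nonneg: "h \<ge> 0 \<Longrightarrow> tree_weight h \<tau> \<ge> 0"
proof (induction \<tau>)
  case (Node a \<tau>s)
  then have "(\<Prod>\<tau>\<in>#\<tau>s. tree_weight h \<tau>) \<ge> 0"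
    by (intro prod_mset_image_nonneg) simp
  with Node.prems show ?case by simp
qed

lemma continuous_on_prod_mset_image:
  fixes g :: "'i \<Rightarrow> 'a::topological_space \<Rightarrow> real"
  assumes "\<And>i. i \<in># M \<Longrightarrow> continuous_on A (g i)"
  shows "continuous_on A (\<lambda>u. \<Prod>i\<in>#M. g i u)"
  using assms by (induction M) (auto intro!: continuous_intros)

lemma abs_prod_mset_le:
  fixes g B :: "'i \<Rightarrow> real"
  assumes "\<And>i. i \<in># M \<Longrightarrow> \<bar>g i\<bar> \<le> B i"
  shows "\<bar>\<Prod>i\<in>#M. g i\<bar> \<le> (\<Prod>i\<in>#M. B i)"
  using assms
proof (induction M)
  case (add i M)
  then have "\<bar>g i\<bar> * \<bar>\<Prod>i\<in>#M. g i\<bar> \<le> B i * (\<Prod>i\<in>#M. B i)"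
    by (intro mult_mono) (auto intro: order_trans[OF abs_ge_zero])
  then show ?case by (simp add: abs_mult)
qed simp

text \<open>The fundamental theorem needs continuous branch integrals, and their continuity comes
  from differentiability. The derivative is therefore first found under a continuity hypothesis on
  the branches, which an induction over the tree then discharges.\<close>

lemma iterated_integral_has_vector_derivative:
  fixes x :: "real \<Rightarrow> real ^ 'd"
  assumes "continuous_on {0..T} (velocity T x)" "s \<in> {0..T}" "u \<in> {0..T}"
  shows "(iterated_integral T x (Node a \<tau>s) s has_vector_derivative
      (\<Prod>\<tau>\<in>#\<tau>s. iterated_integral T x \<tau> s u) * velocity T x u $ a) (at u within {0..T})"
proof -
  have "\<forall>u\<in>{0..T}. (iterated_integral T x (Node a \<tau>s) s has_vector_derivative
      (\<Prod>\<tau>\<in>#\<tau>s. iterated_integral T x \<tau> s u) * velocity T x u $ a) (at u within {0..T})"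
    if "\<And>\<tau>. \<tau> \<in># \<tau>s \<Longrightarrow> continuous_on {0..T} (iterated_integral T x \<tau> s)" for a \<tau>s
  proof
    fix u assume u: "u \<in> {0..T}"
    have "continuous_on {0..T} (\<lambda>u. (\<Prod>\<tau>\<in>#\<tau>s. iterated_integral T x \<tau> s u) * velocity T x u $ a)"
      by (intro continuous_on_mult continuous_on_prod_mset_image that
        bounded_linear.continuous_on[OF bounded_linear_vec_nth assms(1)])
    \<comment> \<open>The base point s may lie anywhere in the interval, so both orientations of the
      integral are covered.\<close>
    from interval_integral_FTC2[OF _ _ this, of s u]
    show "(iterated_integral T x (Node a \<tau>s) s has_vector_derivative
      (\<Prod>\<tau>\<in>#\<tau>s. iterated_integral T x \<tau> s u) * velocity T x u $ a) (at u within {0..T})"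
      using assms(2) u by simp
  qed
  note D = this
  have "continuous_on {0..T} (iterated_integral T x \<tau> s)" for \<tau>
  proof (induction \<tau>)
    case (Node a \<tau>s)
    from D[OF this] show ?case
      using has_vector_derivative_continuous unfolding continuous_on_eq_continuous_within by blast
  qed
  with D assms(3) show ?thesis by blast
qed

lemma iterated_integral_same [simp]: "iterated_integral T x \<tau> s s = 0"
  by (cases \<tau>) simp

lemma vector_derivative_bound:
  fixes F :: "real \<Rightarrow> 'v::real_normed_vector"
  assumes "convex J" "\<And>u. u \<in> J \<Longrightarrow> (F has_vector_derivative F' u) (at u within J)"
    "\<And>u. u \<in> J \<Longrightarrow> norm (F' u) \<le> B" "s \<in> J" "t \<in> J"
  shows "norm (F t - F s) \<le> B * \<bar>t - s\<bar>"
proof -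
  have "norm (F t - F s) \<le> B * norm (t - s)"
  proof (rule differentiable_bound[OF assms(1)])
    show "(F has_derivative (\<lambda>h. h *\<^sub>R F' u)) (at u within J)" if "u \<in> J" for u
      using assms(2)[OF that] by (simp add: has_vector_derivative_def)
    show "onorm (\<lambda>h. h *\<^sub>R F' u) \<le> B" if "u \<in> J" for u
    proof (rule onorm_le)
      show "norm (h *\<^sub>R F' u) \<le> B * norm h" for h
        using mult_left_mono[OF assms(3)[OF that], of "\<bar>h\<bar>"] by (simp add: mult.commute)
    qed
  qed (use assms in auto)
  then show ?thesis by simp
qed

text \<open>Each vertex contributes an integration over a length of at most h against a velocity of
  at most K.\<close>

lemma abs_iterated_integral_le:
  fixes x :: "real \<Rightarrow> real ^ 'd"
  assumes "continuous_on {0..T} (velocity T x)" "\<And>u a. u \<in> J \<Longrightarrow> \<bar>velocity T x u $ a\<bar> \<le> K" "K \<ge> 0"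
    "J \<subseteq> {0..T}" "convex J" "\<And>u v. u \<in> J \<Longrightarrow> v \<in> J \<Longrightarrow> \<bar>u - v\<bar> \<le> h" "s \<in> J" "u \<in> J"
  shows "\<bar>iterated_integral T x \<tau> s u\<bar> \<le> tree_weight (K * h) \<tau>"
  using assms(8)
proof (induction \<tau> arbitrary: u)
  case (Node a \<tau>s)
  let ?B = "\<Prod>\<tau>\<in>#\<tau>s. tree_weight (K * h) \<tau>"
  have h: "h \<ge> 0" using assms(6)[OF assms(7,7)] by simp
  then have "tree_weight (K * h) \<tau> \<ge> 0" for \<tau> :: "'d ltree"
    using assms(3) by (intro tree_weight_nonneg) simp
  then have B: "?B \<ge> 0" by (rule prod_mset_image_nonneg)
  have "norm (iterated_integral T x (Node a \<tau>s) s u - iterated_integral T x (Node a \<tau>s) s s) \<le> (?B * K) * \<bar>u - s\<bar>"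
  proof (rule vector_derivative_bound[OF assms(5) _ _ assms(7) Node.prems])
    fix v assume v: "v \<in> J"
    show "(iterated_integral T x (Node a \<tau>s) s has_vector_derivative
      (\<Prod>\<tau>\<in>#\<tau>s. iterated_integral T x \<tau> s v) * velocity T x v $ a) (at v within J)"
      by (rule has_vector_derivative_within_subset[OF iterated_integral_has_vector_derivative assms(4)])
        (use assms(1,4,7) v in auto)
    have "\<bar>\<Prod>\<tau>\<in>#\<tau>s. iterated_integral T x \<tau> s v\<bar> \<le> ?B"
      by (rule abs_prod_mset_le) (rule Node.IH[OF _ v])
    then show "norm ((\<Prod>\<tau>\<in>#\<tau>s. iterated_integral T x \<tau> s v) * velocity T x v $ a) \<le> ?B * K"
      unfolding real_norm_def abs_mult using assms(2)[OF v] B by (intro mult_mono) auto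
  qed
  also have "\<dots> \<le> (?B * K) * h"
    using B assms(3) assms(6)[OF Node.prems assms(7)] by (intro mult_left_mono) auto
  finally show ?case by (simp only: iterated_integral_same real_norm_def tree_weight.simps diff_0_right mult_ac)
qed

section \<open>Convergence of the tree series\<close>

lemma bij_betw_Node:
  "bij_betw (\<lambda>(a, M). Node a M) (UNIV \<times> {M. set_mset M \<subseteq> A}) {Node a M | a M. set_mset M \<subseteq> A}"
  by (rule bij_betwI[where g = "\<lambda>\<tau>. (case \<tau> of Node a M \<Rightarrow> (a, M))"]) auto

lemma norm_sum_le_trees:
  fixes B :: "'l::finite ltree \<Rightarrow> 'v::banach"
  assumes "\<And>a. norm_sum_le (\<lambda>M. B (Node a M)) {M. set_mset M \<subseteq> A} N"
  shows "norm_sum_le B {Node a M | a M. set_mset M \<subseteq> A} (real CARD('l) * N)"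
proof -
  have "norm_sum_le (\<lambda>p. B ((\<lambda>(a, M). Node a M) p)) (UNIV \<times> {M. set_mset M \<subseteq> A}) (real CARD('l) * N)"
  proof (rule norm_sum_le_Sigma)
    show "((\<lambda>M. norm (B ((\<lambda>(a, M). Node a M) (a, M)))) has_sum
        (\<Sum>\<^sub>\<infinity>M\<in>{M. set_mset M \<subseteq> A}. norm (B (Node a M)))) {M. set_mset M \<subseteq> A}" for a
      using norm_sum_le_infsum(3)[OF assms] by simp
    show "norm_sum_le (\<lambda>a. \<Sum>\<^sub>\<infinity>M\<in>{M. set_mset M \<subseteq> A}. norm (B (Node a M))) UNIV (real CARD('l) * N)"
    proof (rule norm_sum_leI[OF has_sum_finiteI[OF finite refl]])
      show "(\<Sum>a\<in>UNIV. norm (\<Sum>\<^sub>\<infinity>M\<in>{M. set_mset M \<subseteq> A}. norm (B (Node a M)))) \<le> real CARD('l) * N"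
        by (rule sum_bounded_above) (simp only: real_norm_def abs_of_nonneg norm_sum_le_infsum[OF assms])
    qed
  qed
  then show ?thesis by (rule norm_sum_le_reindex[OF bij_betw_Node, THEN iffD1])
qed

lemma all_trees_eq: "{Node a M | a M. set_mset M \<subseteq> UNIV} = UNIV"
  by (auto intro: ltree.exhaust)

lemma has_sum_trees:
  fixes B :: "'l::finite ltree \<Rightarrow> 'v::banach"
  assumes "B summable_on UNIV" "\<And>a. ((\<lambda>M. B (Node a M)) has_sum S a) UNIV"
  shows "(B has_sum (\<Sum>a\<in>UNIV. S a)) UNIV"
proof -
  have bij: "bij_betw (\<lambda>(a :: 'l, M). Node a M) (UNIV \<times> UNIV) UNIV"
    using bij_betw_Node[where A = UNIV] unfolding all_trees_eq by simp
  have "((\<lambda>p. B ((\<lambda>(a, M). Node a M) p)) has_sum (\<Sum>a\<in>UNIV. S a)) (UNIV \<times> UNIV)"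
  proof (rule has_sum_SigmaI)
    show "((\<lambda>M. B ((\<lambda>(a, M). Node a M) (a, M))) has_sum S a) UNIV" for a
      using assms(2) by simp
    show "(\<lambda>p. B ((\<lambda>(a, M). Node a M) p)) summable_on UNIV \<times> UNIV"
      by (rule summable_on_reindex_bij_betw[OF bij, THEN iffD2, OF assms(1)])
  qed (rule has_sum_finiteI[OF finite refl])
  then show ?thesis by (rule has_sum_reindex_bij_betw[OF bij, THEN iffD1])
qed

text \<open>Stage k holds the trees with at most k levels of vertices. The empty stage 0 lets the
  convergence bound start from an empty sum; from k = 2 on the stages are infinite.\<close>

primrec tree_stage :: "nat \<Rightarrow> 'l ltree set" where
  "tree_stage 0 = {}"
| "tree_stage (Suc k) = {Node a M | a M. set_mset M \<subseteq> tree_stage k}"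

lemma tree_stage_mono: "j \<le> k \<Longrightarrow> tree_stage j \<subseteq> tree_stage k"
proof -
  have "tree_stage k \<subseteq> tree_stage (Suc k)" for k
  proof (induction k)
    case (Suc k)
    then show ?case unfolding tree_stage.simps(2)[of "Suc k"] tree_stage.simps(2)[of k] by blast
  qed simp
  then show "j \<le> k \<Longrightarrow> tree_stage j \<subseteq> tree_stage k" by (rule lift_Suc_mono_le)
qed

lemma finite_subset_tree_stage:
  assumes "finite F" "\<And>\<tau>. \<tau> \<in> F \<Longrightarrow> \<exists>k. \<tau> \<in> tree_stage k"
  shows "\<exists>k. F \<subseteq> tree_stage k"
  using assms
proof (induction F)
  case (insert \<tau> F)
  then obtain k where "F \<subseteq> tree_stage k" by blast
  moreover obtain j where "\<tau> \<in> tree_stage j" using insert.prems by blast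
  ultimately
  have "insert \<tau> F \<subseteq> tree_stage (max j k)"
    using tree_stage_mono[of j "max j k"] tree_stage_mono[of k "max j k"] by auto
  then show ?case ..
qed simp

lemma tree_in_stage: "\<exists>k. \<tau> \<in> tree_stage k"
proof (induction \<tau>)
  case (Node a M)
  from finite_subset_tree_stage[OF _ this] obtain k where "set_mset M \<subseteq> tree_stage k" by auto
  then have "Node a M \<in> tree_stage (Suc k)" by simp
  then show ?case ..
qed

lemma norm_sum_le_scaleR:
  fixes f :: "'a \<Rightarrow> 'b::banach"
  assumes "norm_sum_le f A N"
  shows "norm_sum_le (\<lambda>x. k *\<^sub>R f x) A (\<bar>k\<bar> * N)"
proof (rule norm_sum_leI)
  show "((\<lambda>x. norm (k *\<^sub>R f x)) has_sum (\<bar>k\<bar> * (\<Sum>\<^sub>\<infinity>x\<in>A. norm (f x)))) A"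
    using has_sum_cmult_right[OF norm_sum_le_infsum(3)[OF assms], of "\<bar>k\<bar>"] by simp
  show "\<bar>k\<bar> * (\<Sum>\<^sub>\<infinity>x\<in>A. norm (f x)) \<le> \<bar>k\<bar> * N"
    by (rule mult_left_mono[OF norm_sum_le_infsum(1)[OF assms]]) simp
qed

text \<open>The bound S reproduces itself because the branch sum is at most N for every input of
  absolute sum at most \<rho>; the root adds the factor h, and the choice of its label the factor
  \<open>CARD('l)\<close>.\<close>

lemma norm_sum_le_tree_weight:
  fixes f :: "'l::finite \<Rightarrow> real ^ 'n \<Rightarrow> real ^ 'n"
  assumes "\<And>a. \<exists>c. series_on_box c \<rho> N (f a) \<xi>" "\<rho> > 0" "h \<ge> 0"
    "real CARD('l) * (h * N) \<le> S" "0 \<le> S" "S \<le> \<rho>"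
  shows "norm_sum_le (\<lambda>\<tau>. (tree_weight h \<tau> / symmetry_factor \<tau>) *\<^sub>R elementary_differential f \<tau> \<xi>) UNIV S"
    (is "norm_sum_le ?p _ _")
proof -
  have stage: "norm_sum_le ?p (tree_stage k) S" for k
  proof (induction k)
    case 0
    show ?case using assms(5) by (simp add: norm_sum_le_def)
  next
    case (Suc k)
    have "norm_sum_le (\<lambda>M. ?p (Node a M)) {M. set_mset M \<subseteq> tree_stage k} (h * N)" for a
    proof -
      obtain c where c: "series_on_box c \<rho> N (f a) \<xi>" using assms(1) by blast
      let ?w = "\<lambda>M. ((\<Prod>\<tau>\<in>#M. tree_weight h \<tau>) / symmetry_factor (Node a M)) *\<^sub>R elementary_differential f (Node a M) \<xi>"
      have "norm_sum_le ?w {M. set_mset M \<subseteq> tree_stage k} N"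
        by (rule branch_sum(1)[OF c assms(2) Suc assms(6)])
      moreover have "?p (Node a M) = h *\<^sub>R ?w M" for M
        by (simp only: tree_weight.simps scaleR_scaleR times_divide_eq_right)
      ultimately show ?thesis
        using norm_sum_le_scaleR[of ?w _ N h] assms(3) by (simp only: abs_of_nonneg)
    qed
    then have "norm_sum_le ?p {Node a M | a M. set_mset M \<subseteq> tree_stage k} (real CARD('l) * (h * N))"
      by (rule norm_sum_le_trees)
    then show ?case unfolding tree_stage.simps by (rule norm_sum_le_weaken[OF _ assms(4)])
  qed
  show ?thesis
    unfolding norm_sum_le_finite_sums
  proof (intro allI impI)
    fix F :: "'l ltree set" assume F: "finite F"
    obtain k where "F \<subseteq> tree_stage k" using finite_subset_tree_stage[OF F tree_in_stage] ..
    then show "(\<Sum>\<tau>\<in>F. norm (?p \<tau>)) \<le> S"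
      using stage[of k] F unfolding norm_sum_le_finite_sums by blast
  qed
qed

text \<open>In a nonconstant monomial one factor norm v is kept and the others are enlarged to r,
  which leaves norm v / r times the absolute sum at the corner.\<close>

lemma series_on_box_lipschitz:
  fixes c :: "('n::finite \<Rightarrow> nat) \<Rightarrow> 'v::banach"
  assumes "series_on_box c r N g p" "r > 0" "norm v \<le> r"
  shows "norm (g (p + v) - g p) \<le> N / r * norm v"
proof -
  let ?X = "UNIV - {\<lambda>i. 0}"
  have c: "norm_sum_le (\<lambda>\<alpha>. r ^ sum \<alpha> UNIV *\<^sub>R c \<alpha>) UNIV N"
    using assms(1) by (simp add: series_on_box_def)
  have "\<bar>v $ i\<bar> \<le> r" for i using component_le_norm_cart[of v i] assms(3) by linarith
  then have "((\<lambda>\<alpha>. monom_at v \<alpha> *\<^sub>R c \<alpha>) has_sum g (p + v)) UNIV"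
    using assms(1) unfolding series_on_box_def by blast
  moreover have "((\<lambda>\<alpha>. monom_at v \<alpha> *\<^sub>R c \<alpha>) has_sum g p) {\<lambda>i. 0}"
    by (rule has_sum_finiteI) (simp_all add: monom_at_def series_on_box_centre(1)[OF assms(1,2)])
  ultimately have "((\<lambda>\<alpha>. monom_at v \<alpha> *\<^sub>R c \<alpha>) has_sum (g (p + v) - g p)) ?X"
    by (rule has_sum_Diff) simp
  moreover have "norm_sum_le (\<lambda>\<alpha>. monom_at v \<alpha> *\<^sub>R c \<alpha>) ?X (\<bar>norm v / r\<bar> * N)"
  proof (rule norm_sum_le_comparison)
    show "norm_sum_le (\<lambda>\<alpha>. (norm v / r) *\<^sub>R (r ^ sum \<alpha> UNIV *\<^sub>R c \<alpha>)) ?X (\<bar>norm v / r\<bar> * N)"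
      by (intro norm_sum_le_scaleR norm_sum_le_subset[OF c]) simp
    fix \<alpha> :: "'n \<Rightarrow> nat" assume "\<alpha> \<in> ?X"
    then have "sum \<alpha> UNIV \<noteq> 0" by (auto simp: fun_eq_iff)
    then obtain k where k: "sum \<alpha> UNIV = Suc k" using not0_implies_Suc by blast
    have "\<bar>monom_at v \<alpha>\<bar> \<le> norm v ^ sum \<alpha> UNIV"
      by (rule abs_monom_at_le) (rule component_le_norm_cart)
    also have "\<dots> \<le> norm v * r ^ k"
      unfolding k using assms(3) by (auto intro!: mult_left_mono power_mono)
    also have "\<dots> = norm v / r * r ^ sum \<alpha> UNIV"
      unfolding k using assms(2) by simp
    finally show "norm (monom_at v \<alpha> *\<^sub>R c \<alpha>) \<le> norm ((norm v / r) *\<^sub>R (r ^ sum \<alpha> UNIV *\<^sub>R c \<alpha>))"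
      using assms(2) mult_right_mono[of "\<bar>monom_at v \<alpha>\<bar>" "norm v / r * r ^ sum \<alpha> UNIV" "norm (c \<alpha>)"]
      by (simp add: mult.assoc)
  qed
  ultimately have "norm (g (p + v) - g p) \<le> \<bar>norm v / r\<bar> * N"
    by (rule norm_sum_le_norm_has_sum[rotated])
  then show ?thesis using assms(2) by (simp add: mult.commute)
qed

lemma velocity_continuous:
  fixes x :: "real \<Rightarrow> 'v::euclidean_space"
  assumes "C1_path T x" "T > 0"
  shows "continuous_on {0..T} (velocity T x)"
proof -
  obtain x' where x': "\<forall>t\<in>{0..T}. (x has_vector_derivative x' t) (at t within {0..T})"
    "continuous_on {0..T} x'"
    using assms(1) unfolding C1_path_def by blast
  have "velocity T x t = x' t" if "t \<in> {0..T}" for t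
    unfolding velocity_def
    by (rule vector_derivative_within_closed_interval[OF assms(2) that]) (use x' that in blast)
  then show ?thesis using x'(2) continuous_on_cong by (metis (mono_tags, lifting))
qed

section \<open>Comparison of the solution with the tree series on a short interval\<close>

context
  fixes T K N h \<rho> :: real and \<eta> :: "real ^ 'n" and x :: "real \<Rightarrow> real ^ 'd"
    and f :: "'d \<Rightarrow> real ^ 'n \<Rightarrow> real ^ 'n" and y :: "real \<Rightarrow> real ^ 'n" and J :: "real set"
    and s :: real
  assumes vel_cont: "continuous_on {0..T} (velocity T x)"
    and vel_le: "\<And>u a. u \<in> J \<Longrightarrow> \<bar>velocity T x u $ a\<bar> \<le> K" and K: "K \<ge> 0"
    and \<rho>: "\<rho> > 0"
    and series: "\<And>a \<xi>. norm (\<xi> - \<eta>) \<le> \<rho> \<Longrightarrow> \<exists>c. series_on_box c \<rho> N (f a) \<xi>"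
    and J: "J \<subseteq> {0..T}" "convex J" and diam: "\<And>u v. u \<in> J \<Longrightarrow> v \<in> J \<Longrightarrow> \<bar>u - v\<bar> \<le> h"
    \<comment> \<open>This has two uses: it bounds the tree series by \<rho> / 2, and it makes the
      Lipschitz factor \<open>CARD('d) * K * N / \<rho>\<close> times the length h at most 1 /
      2.\<close>
    and small: "real CARD('d) * (K * h * N) \<le> \<rho> / 2"
    \<comment> \<open>Twice \<rho> / 4, together with \<rho> / 2 for the tree series, gives \<rho>:
      then \<open>y s + tree_sum u\<close> is within reach of the expansion at
      \<open>y u\<close>.\<close>
    and y_near: "\<And>u. u \<in> J \<Longrightarrow> norm (y u - \<eta>) \<le> \<rho> / 4"
    and y_deriv: "\<And>u. u \<in> J \<Longrightarrow> (y has_vector_derivative (\<Sum>a\<in>UNIV. (velocity T x u $ a) *\<^sub>R f a (y u))) (at u within J)"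
    and s: "s \<in> J"
begin

definition tree_term :: "real \<Rightarrow> 'd ltree \<Rightarrow> real ^ 'n" where
  "tree_term u \<tau> = (iterated_integral T x \<tau> s u / symmetry_factor \<tau>) *\<^sub>R elementary_differential f \<tau> (y s)"

definition tree_sum :: "real \<Rightarrow> real ^ 'n" where
  "tree_sum u = (\<Sum>\<^sub>\<infinity>\<tau>. tree_term u \<tau>)"

text \<open>Differentiation removes the integration at the root. For a fixed root label what remains
  is the velocity times the family w of \<open>branch_sum\<close>.\<close>

definition tree_term_deriv :: "real \<Rightarrow> 'd ltree \<Rightarrow> real ^ 'n" where
  "tree_term_deriv u \<tau> = (case \<tau> of Node a M \<Rightarrow>
     velocity T x u $ a *\<^sub>R (((\<Prod>\<sigma>\<in>#M. iterated_integral T x \<sigma> s u) / symmetry_factor \<tau>) *\<^sub>R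
       elementary_differential f \<tau> (y s)))"

definition vector_field :: "real \<Rightarrow> real ^ 'n \<Rightarrow> real ^ 'n" where
  "vector_field u w = (\<Sum>a\<in>UNIV. (velocity T x u $ a) *\<^sub>R f a w)"

lemma h_nonneg: "h \<ge> 0" using diam[OF s s] by simp

lemma N_nonneg: "N \<ge> 0"
  using series[of \<eta>] \<rho> unfolding series_on_box_def by (auto dest: norm_sum_le_nonneg)

lemma series_at_y: "u \<in> J \<Longrightarrow> \<exists>c. series_on_box c \<rho> N (f a) (y u)"
  using series[of "y u"] y_near[of u] \<rho> by simp

lemma norm_sum_le_tree_term:
  assumes "u \<in> J"
  shows "norm_sum_le (tree_term u) UNIV (\<rho> / 2)"
proof (rule norm_sum_le_comparison)
  show "norm_sum_le (\<lambda>\<tau>. (tree_weight (K * h) \<tau> / symmetry_factor \<tau>) *\<^sub>R elementary_differential f \<tau> (y s)) UNIV (\<rho> / 2)"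
    by (rule norm_sum_le_tree_weight[where \<rho> = \<rho>]) (use series_at_y[OF s] \<rho> K h_nonneg small in auto)
  show "norm (tree_term u \<tau>) \<le> norm ((tree_weight (K * h) \<tau> / symmetry_factor \<tau>) *\<^sub>R elementary_differential f \<tau> (y s))" for \<tau>
  proof -
    have "\<bar>iterated_integral T x \<tau> s u\<bar> \<le> tree_weight (K * h) \<tau>"
      by (rule abs_iterated_integral_le[OF vel_cont vel_le K J diam s assms])
    then have "\<bar>iterated_integral T x \<tau> s u\<bar> / symmetry_factor \<tau> \<le> \<bar>tree_weight (K * h) \<tau>\<bar> / symmetry_factor \<tau>"
      using symmetry_factor_pos[of \<tau>] by (intro divide_right_mono) auto
    then show ?thesis
      unfolding tree_term_def norm_scaleR
      using symmetry_factor_pos[of \<tau>] by (intro mult_right_mono) auto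
  qed
qed

lemma has_sum_tree_sum: "u \<in> J \<Longrightarrow> (tree_term u has_sum tree_sum u) UNIV"
  unfolding tree_sum_def by (rule has_sum_infsum[OF norm_sum_le_summable[OF norm_sum_le_tree_term]])

lemma norm_tree_sum_le: "u \<in> J \<Longrightarrow> norm (tree_sum u) \<le> \<rho> / 2"
  by (rule norm_sum_le_norm_has_sum[OF norm_sum_le_tree_term has_sum_tree_sum])

lemma tree_term_has_vector_derivative:
  assumes "u \<in> J"
  shows "((\<lambda>u. tree_term u \<tau>) has_vector_derivative tree_term_deriv u \<tau>) (at u within J)"
proof (cases \<tau>)
  case (Node a M)
  have "(iterated_integral T x (Node a M) s has_vector_derivative
      (\<Prod>\<sigma>\<in>#M. iterated_integral T x \<sigma> s u) * velocity T x u $ a) (at u within J)"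
    by (rule has_vector_derivative_within_subset[OF iterated_integral_has_vector_derivative[OF vel_cont] J(1)])
      (use J(1) s assms in auto)
  from bounded_linear.has_vector_derivative[OF bounded_linear_scaleR_left
      bounded_linear.has_vector_derivative[OF bounded_linear_mult_left this, of "1 / symmetry_factor \<tau>"],
      of "elementary_differential f \<tau> (y s)"]
  show ?thesis
    unfolding tree_term_def tree_term_deriv_def Node ltree.case scaleR_scaleR
    by (simp only: times_divide_eq_right times_divide_eq_left mult_1_left mult_1_right mult.commute)
qed

text \<open>The majorant must not depend on u, as it feeds the Weierstrass test;
  \<open>branch_sum\<close> with the weights in place of the integrals supplies it.\<close>

lemma tree_term_deriv_dominated:
  "\<exists>m. m summable_on UNIV \<and> (\<forall>\<tau>. \<forall>u\<in>J. norm (tree_term_deriv u \<tau>) \<le> m \<tau>)"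
proof -
  define B where "B \<tau> = (case \<tau> of Node a M \<Rightarrow>
      K *\<^sub>R (((\<Prod>\<sigma>\<in>#M. tree_weight (K * h) \<sigma>) / symmetry_factor \<tau>) *\<^sub>R elementary_differential f \<tau> (y s)))" for \<tau>
  have w: "norm_sum_le (\<lambda>\<tau>. (tree_weight (K * h) \<tau> / symmetry_factor \<tau>) *\<^sub>R elementary_differential f \<tau> (y s)) UNIV (\<rho> / 2)"
    by (rule norm_sum_le_tree_weight[where \<rho> = \<rho>]) (use series_at_y[OF s] \<rho> K h_nonneg small in auto)
  have "norm_sum_le (\<lambda>M. B (Node a M)) {M. set_mset M \<subseteq> UNIV} (\<bar>K\<bar> * N)" for a
  proof -
    obtain c where c: "series_on_box c \<rho> N (f a) (y s)" using series_at_y[OF s] by blast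
    show ?thesis unfolding B_def ltree.case
      by (rule norm_sum_le_scaleR[OF branch_sum(1)[OF c \<rho> w]]) (use \<rho> in simp)
  qed
  from norm_sum_le_trees[OF this] have "B abs_summable_on UNIV"
    unfolding all_trees_eq by (rule norm_sum_le_abs_summable)
  moreover have "norm (tree_term_deriv u \<tau>) \<le> norm (B \<tau>)" if u: "u \<in> J" for u \<tau>
  proof (cases \<tau>)
    case (Node a M)
    have p: "\<bar>\<Prod>\<sigma>\<in>#M. iterated_integral T x \<sigma> s u\<bar> \<le> (\<Prod>\<sigma>\<in>#M. tree_weight (K * h) \<sigma>)"
      by (rule abs_prod_mset_le) (rule abs_iterated_integral_le[OF vel_cont vel_le K J diam s u])
    have "\<bar>(\<Prod>\<sigma>\<in>#M. iterated_integral T x \<sigma> s u) / symmetry_factor \<tau>\<bar>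
        \<le> \<bar>(\<Prod>\<sigma>\<in>#M. tree_weight (K * h) \<sigma>) / symmetry_factor \<tau>\<bar>"
      unfolding abs_divide by (rule divide_right_mono) (use p in auto)
    then show ?thesis
      unfolding tree_term_deriv_def B_def Node ltree.case norm_scaleR
      using vel_le[OF u, of a] K by (intro mult_mono mult_right_mono) auto
  qed
  ultimately show ?thesis by blast
qed

text \<open>Grouping by root label and applying \<open>branch_sum\<close> with
  \<open>tree_sum u\<close> for v: this is the sense in which the series formally solves the
  equation.\<close>

lemma has_sum_tree_term_deriv:
  assumes "u \<in> J"
  shows "(tree_term_deriv u has_sum vector_field u (y s + tree_sum u)) UNIV"
  unfolding vector_field_def
proof (rule has_sum_trees)
  obtain m where m: "m summable_on UNIV" "\<And>\<tau>. norm (tree_term_deriv u \<tau>) \<le> m \<tau>"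
    using tree_term_deriv_dominated assms by blast
  have "tree_term_deriv u abs_summable_on UNIV"
    by (rule Infinite_Sum.abs_summable_on_comparison_test'[OF m(1) m(2)])
  then show "tree_term_deriv u summable_on UNIV" by (rule abs_summable_summable)
  show "((\<lambda>M. tree_term_deriv u (Node a M)) has_sum velocity T x u $ a *\<^sub>R f a (y s + tree_sum u)) UNIV" for a
  proof -
    obtain c where c: "series_on_box c \<rho> N (f a) (y s)" using series_at_y[OF s] by blast
    have "\<rho> / 2 \<le> \<rho>" using \<rho> by simp
    from branch_sum(2)[where X = "\<lambda>\<tau>. iterated_integral T x \<tau> s u", OF c \<rho>
        norm_sum_le_tree_term[OF assms, unfolded tree_term_def[abs_def]] this
        has_sum_tree_sum[OF assms, unfolded tree_term_def[abs_def]]]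
    have "((\<lambda>M. ((\<Prod>\<tau>\<in>#M. iterated_integral T x \<tau> s u) / symmetry_factor (Node a M)) *\<^sub>R
         elementary_differential f (Node a M) (y s)) has_sum f a (y s + tree_sum u)) UNIV"
      by simp
    from has_sum_bounded_linear[OF bounded_linear_scaleR_right this, of "velocity T x u $ a"]
    show ?thesis unfolding tree_term_deriv_def ltree.case o_def .
  qed
qed

text \<open>The expansion is centred at the solution \<open>y u\<close>, which is known to stay near
  \<eta>, and its box contains \<open>y s + tree_sum u\<close>.\<close>

lemma vector_field_diff_le:
  assumes "u \<in> J"
  shows "norm (vector_field u (y u) - vector_field u (y s + tree_sum u))
    \<le> real CARD('d) * (K * (N / \<rho> * norm (y u - (y s + tree_sum u))))"
proof -
  define v where "v = y s + tree_sum u - y u"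
  have "norm v \<le> norm (y s - \<eta>) + norm (y u - \<eta>) + norm (tree_sum u)"
    unfolding v_def by norm
  then have v: "norm v \<le> \<rho>"
    using y_near[OF s] y_near[OF assms] norm_tree_sum_le[OF assms] by linarith
  have "norm (f a (y u + v) - f a (y u)) \<le> N / \<rho> * norm v" for a
    using series_at_y[OF assms] series_on_box_lipschitz[OF _ \<rho> v] by blast
  then have "norm (velocity T x u $ a *\<^sub>R (f a (y u + v) - f a (y u))) \<le> K * (N / \<rho> * norm v)" for a
    unfolding norm_scaleR using vel_le[OF assms, of a] K by (intro mult_mono) auto
  then have "norm (\<Sum>a\<in>UNIV. velocity T x u $ a *\<^sub>R (f a (y u + v) - f a (y u))) \<le> real CARD('d) * (K * (N / \<rho> * norm v))"
    by (intro order_trans[OF norm_sum] sum_bounded_above)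
  moreover have "(\<Sum>a\<in>UNIV. velocity T x u $ a *\<^sub>R (f a (y u + v) - f a (y u))) = vector_field u (y u + v) - vector_field u (y u)"
    unfolding vector_field_def by (simp add: scaleR_diff_right sum_subtractf)
  moreover have "y u + v = y s + tree_sum u" by (simp add: v_def)
  ultimately show ?thesis by (simp add: norm_minus_commute v_def)
qed

text \<open>The mean value inequality is applied to y minus a finite partial sum, whose derivative
  is at most the Lipschitz bound plus \<epsilon>, uniformly on J. Letting the finite set grow avoids
  differentiating the infinite series.\<close>

lemma distance_halves:
  assumes C: "\<And>u. u \<in> J \<Longrightarrow> norm (y u - (y s + tree_sum u)) \<le> C" and t: "t \<in> J"
  shows "norm (y t - (y s + tree_sum t)) \<le> C / 2"
proof (rule field_le_epsilon)
  fix e :: real assume e: "e > 0"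
  \<comment> \<open>The summand 1 is there because h may be 0; the error accumulated over J is at
    most \<epsilon> * h \<le> e.\<close>
  define \<epsilon> where "\<epsilon> = e / (h + 1)"
  have \<epsilon>: "\<epsilon> > 0" "\<epsilon> * h \<le> e" using e h_nonneg by (auto simp: \<epsilon>_def field_simps)
  have C0: "C \<ge> 0" using C[OF t] norm_ge_zero order_trans by blast
  obtain m where m: "m summable_on UNIV" "\<And>\<tau> u. u \<in> J \<Longrightarrow> norm (tree_term_deriv u \<tau>) \<le> m \<tau>"
    using tree_term_deriv_dominated by blast
  have "uniform_limit J (\<lambda>F u. \<Sum>\<tau>\<in>F. tree_term_deriv u \<tau>) (\<lambda>u. vector_field u (y s + tree_sum u)) (finite_subsets_at_top UNIV)"
    by (rule Weierstrass_m_test_general'[OF _ has_sum_tree_term_deriv m(1)]) (use m(2) in auto)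
  then have ev: "\<forall>\<^sub>F F in finite_subsets_at_top UNIV. \<forall>u\<in>J.
      dist (\<Sum>\<tau>\<in>F. tree_term_deriv u \<tau>) (vector_field u (y s + tree_sum u)) < \<epsilon>"
    using \<epsilon>(1) by (rule uniform_limitD)
  have "\<forall>\<^sub>F F in finite_subsets_at_top UNIV. norm (y t - (y s + (\<Sum>\<tau>\<in>F. tree_term t \<tau>))) \<le> C / 2 + e"
    using ev
  proof eventually_elim
    case (elim F)
    let ?E = "\<lambda>u. y u - (\<Sum>\<tau>\<in>F. tree_term u \<tau>)"
    let ?L = "real CARD('d) * (K * (N / \<rho> * C))"
    have "norm (?E t - ?E s) \<le> (?L + \<epsilon>) * \<bar>t - s\<bar>"
    proof (rule vector_derivative_bound[OF J(2) _ _ s t])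
      fix u assume u: "u \<in> J"
      show "(?E has_vector_derivative (vector_field u (y u) - (\<Sum>\<tau>\<in>F. tree_term_deriv u \<tau>))) (at u within J)"
        unfolding vector_field_def
        by (intro has_vector_derivative_diff has_vector_derivative_sum y_deriv tree_term_has_vector_derivative u)
      have "real CARD('d) * (K * (N / \<rho> * norm (y u - (y s + tree_sum u)))) \<le> ?L"
        using C[OF u] K N_nonneg \<rho> by (intro mult_left_mono) auto
      with vector_field_diff_le[OF u]
      have "norm (vector_field u (y u) - vector_field u (y s + tree_sum u)) \<le> ?L"
        by (rule order_trans)
      moreover have "norm (vector_field u (y s + tree_sum u) - (\<Sum>\<tau>\<in>F. tree_term_deriv u \<tau>)) \<le> \<epsilon>"
        using bspec[OF elim u] by (simp add: dist_norm norm_minus_commute)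
      ultimately show "norm (vector_field u (y u) - (\<Sum>\<tau>\<in>F. tree_term_deriv u \<tau>)) \<le> ?L + \<epsilon>"
        by (rule norm_diff_triangle_le)
    qed
    also have "\<dots> \<le> (?L + \<epsilon>) * h"
      using diam[OF t s] K N_nonneg \<rho> C0 \<epsilon>(1) by (intro mult_left_mono) auto
    \<comment> \<open>The grouping isolates the left-hand side of \<open>small\<close>.\<close>
    also have "\<dots> = real CARD('d) * (K * h * N) * (C / \<rho>) + \<epsilon> * h"
      by (simp add: field_simps)
    also have "\<dots> \<le> (\<rho> / 2) * (C / \<rho>) + e"
      by (intro add_mono mult_right_mono small \<epsilon>(2)) (use C0 \<rho> in auto)
    also have "\<dots> = C / 2 + e" using \<rho> by simp
    \<comment> \<open>At time s all iterated integrals vanish, so \<open>?E s\<close> is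
      \<open>y s\<close>.\<close>
    finally show ?case by (simp add: tree_term_def algebra_simps)
  qed
  moreover have "((\<lambda>F. norm (y t - (y s + (\<Sum>\<tau>\<in>F. tree_term t \<tau>)))) \<longlongrightarrow> norm (y t - (y s + tree_sum t))) (finite_subsets_at_top UNIV)"
    using has_sum_tree_sum[OF t] unfolding has_sum_def by (intro tendsto_intros)
  ultimately show "norm (y t - (y s + tree_sum t)) \<le> C / 2 + e"
    by (intro tendsto_upperbound) auto
qed

text \<open>The initial distance is at most \<rho> / 4 + \<rho> / 4 + \<rho> / 2 on all of J, and
  \<open>distance_halves\<close> can be iterated because it again gives a bound on all of J.\<close>

lemma solution_eq_tree_sum:
  assumes "t \<in> J"
  shows "y t = y s + tree_sum t"
proof -
  have "norm (y u - (y s + tree_sum u)) \<le> \<rho> / 2 ^ k" if "u \<in> J" for u k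
    using that
  proof (induction k arbitrary: u)
    case 0
    have "norm (y u - (y s + tree_sum u)) \<le> norm (y s - \<eta>) + norm (y u - \<eta>) + norm (tree_sum u)"
      by norm
    then show ?case
      using y_near[OF s] y_near[OF 0] norm_tree_sum_le[OF 0] by simp
  next
    case (Suc k)
    then show ?case using distance_halves[OF Suc.IH] by (simp add: mult.commute)
  qed
  moreover have "(\<lambda>k. \<rho> / 2 ^ k) \<longlonglongrightarrow> 0" by (rule LIMSEQ_divide_realpow_zero) simp
  ultimately have "norm (y t - (y s + tree_sum t)) \<le> 0"
    using assms by (intro LIMSEQ_le_const[of "\<lambda>k. \<rho> / 2 ^ k"]) auto
  then show ?thesis by simp
qed

lemma tree_series_representation:
  assumes "t \<in> J"
  shows "(\<lambda>\<tau>. norm ((1 / symmetry_factor \<tau>) *\<^sub>R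
             (iterated_integral T x \<tau> s t *\<^sub>R elementary_differential f \<tau> (y s)))) summable_on UNIV"
    and "((\<lambda>\<tau>. (1 / symmetry_factor \<tau>) *\<^sub>R
             (iterated_integral T x \<tau> s t *\<^sub>R elementary_differential f \<tau> (y s))) has_sum (y t - y s)) UNIV"
proof -
  have *: "(\<lambda>\<tau>. (1 / symmetry_factor \<tau>) *\<^sub>R
             (iterated_integral T x \<tau> s t *\<^sub>R elementary_differential f \<tau> (y s))) = tree_term t"
    by (simp add: tree_term_def fun_eq_iff)
  show "(\<lambda>\<tau>. norm ((1 / symmetry_factor \<tau>) *\<^sub>R
             (iterated_integral T x \<tau> s t *\<^sub>R elementary_differential f \<tau> (y s)))) summable_on UNIV"
    using norm_sum_le_abs_summable[OF norm_sum_le_tree_term[OF assms]] by (simp add: tree_term_def)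
  show "((\<lambda>\<tau>. (1 / symmetry_factor \<tau>) *\<^sub>R
             (iterated_integral T x \<tau> s t *\<^sub>R elementary_differential f \<tau> (y s))) has_sum (y t - y s)) UNIV"
    unfolding * using has_sum_tree_sum[OF assms] solution_eq_tree_sum[OF assms] by simp
qed

end

theorem theorem5p1:
  fixes T R \<delta> :: real
    and x :: "real \<Rightarrow> real ^ 'd"
    and \<eta> :: "real ^ 'n"
    and f :: "'d \<Rightarrow> real ^ 'n \<Rightarrow> real ^ 'n"
    and y :: "real \<Rightarrow> real ^ 'n"
  assumes "T > 0"
    and "C1_path T x"
    and "\<And>a i. real_analytic (\<lambda>\<xi>. f a \<xi> $ i)"
    and "R > 0"
    and "\<And>a i. power_series_on_ball (\<lambda>\<xi>. f a \<xi> $ i) \<eta> R"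
    and "\<delta> > 0"
    and "solves_on T x f \<eta> y ({0..T} \<inter> {0..<\<delta>})"
  shows "\<exists>t0. 0 < t0 \<and> t0 \<le> \<delta> \<and>
    (\<forall>s \<in> {0..T} \<inter> {0..<t0}. \<forall>t \<in> {0..T} \<inter> {0..<t0}.
       (\<lambda>\<tau>. norm ((1 / symmetry_factor \<tau>) *\<^sub>R
             (iterated_integral T x \<tau> s t *\<^sub>R elementary_differential f \<tau> (y s)))) summable_on UNIV \<and>
       ((\<lambda>\<tau>. (1 / symmetry_factor \<tau>) *\<^sub>R
             (iterated_integral T x \<tau> s t *\<^sub>R elementary_differential f \<tau> (y s))) has_sum (y t - y s)) UNIV)"
proof -
  let ?I = "{0..T} \<inter> {0..<\<delta>}"
  have vel_cont: "continuous_on {0..T} (velocity T x)"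
    by (rule velocity_continuous[OF assms(2,1)])
  then have "bounded (velocity T x ` {0..T})"
    by (intro compact_imp_bounded compact_continuous_image) auto
  then obtain K where K: "\<And>u. u \<in> {0..T} \<Longrightarrow> norm (velocity T x u) \<le> K"
    unfolding bounded_iff ball_simps by blast
  have "norm (velocity T x 0) \<le> K" by (rule K) (use assms(1) in simp)
  then have K0: "K \<ge> 0" by (rule order_trans[OF norm_ge_zero])
  have vel_le: "\<bar>velocity T x u $ a\<bar> \<le> K" if "u \<in> {0..T}" for u a
    using K[OF that] component_le_norm_cart[of "velocity T x u" a] by linarith
  from uniform_series_on_box[of f, OF assms(5,4)]
  obtain \<rho> N where \<rho>: "\<rho> > 0" "N \<ge> 0"
    and series: "\<And>a \<xi>. norm (\<xi> - \<eta>) \<le> \<rho> \<Longrightarrow> \<exists>c. series_on_box c \<rho> N (f a) \<xi>"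
    by blast
  have y0: "y 0 = \<eta>"
    and y': "\<And>u. u \<in> ?I \<Longrightarrow> (y has_vector_derivative (\<Sum>a\<in>UNIV. (velocity T x u $ a) *\<^sub>R f a (y u))) (at u within ?I)"
    using assms(7) unfolding solves_on_def by simp_all
  have "0 \<in> ?I" using assms(1,6) by simp
  note cont = has_vector_derivative_continuous[OF y'[OF this], unfolded continuous_within_eps_delta]
  \<comment> \<open>Continuity at time 0 suffices, since all times considered will be close to
    0.\<close>
  have "\<exists>d>0. \<forall>u\<in>?I. dist u 0 < d \<longrightarrow> dist (y u) (y 0) < \<rho> / 4"
    by (rule cont[rule_format]) (use \<rho>(1) in simp)
  then obtain d where d: "d > 0" "\<And>u. u \<in> ?I \<Longrightarrow> dist u 0 < d \<Longrightarrow> dist (y u) (y 0) < \<rho> / 4"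
    by blast
  define L where "L = real CARD('d) * (K * N)"
  have L: "L \<ge> 0" using K0 \<rho> by (simp add: L_def)
  \<comment> \<open>\<delta> keeps the interval inside the domain of the solution, d keeps y within
    \<rho> / 4 of \<eta>, and the last term yields L * t0 \<le> \<rho> / 2; L + 1 avoids a division
    by 0. The bound t0 on the diameter takes the place of h.\<close>
  define t0 where "t0 = min \<delta> (min d (\<rho> / (2 * (L + 1))))"
  have t0: "0 < t0" "t0 \<le> \<delta>" "t0 \<le> d" using assms(6) d(1) \<rho>(1) L by (auto simp: t0_def)
  have "L * t0 \<le> (L + 1) * (\<rho> / (2 * (L + 1)))"
    by (rule mult_mono) (use L t0(1) in \<open>simp_all add: t0_def\<close>)
  also have "\<dots> = \<rho> / 2" using L by (simp add: field_simps)
  finally have small: "real CARD('d) * (K * t0 * N) \<le> \<rho> / 2" by (simp add: L_def mult_ac)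
  let ?J = "{0..T} \<inter> {0..<t0}"
  have J: "?J \<subseteq> {0..T}" "convex ?J" "\<And>u v. u \<in> ?J \<Longrightarrow> v \<in> ?J \<Longrightarrow> \<bar>u - v\<bar> \<le> t0"
    by (auto intro: convex_Int convex_real_interval)
  have sub: "?J \<subseteq> ?I" using t0(2) by auto
  have y_near: "norm (y u - \<eta>) \<le> \<rho> / 4" if "u \<in> ?J" for u
    using d(2)[of u] that sub t0(3) y0 by (auto simp: dist_norm)
  have y_deriv: "(y has_vector_derivative (\<Sum>a\<in>UNIV. (velocity T x u $ a) *\<^sub>R f a (y u))) (at u within ?J)"
    if "u \<in> ?J" for u
    by (rule has_vector_derivative_within_subset[OF y' sub]) (use sub that in blast)
  have vel_le': "\<bar>velocity T x u $ a\<bar> \<le> K" if "u \<in> ?J" for u a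
    using vel_le that by blast
  show ?thesis
  proof (intro exI[of _ t0] conjI ballI)
    fix s t assume st: "s \<in> ?J" "t \<in> ?J"
    note rep = tree_series_representation[where K = K and N = N and h = t0 and \<rho> = \<rho> and \<eta> = \<eta> and T = T
        and x = x and f = f and y = y and J = ?J and s = s and t = t,
        OF vel_cont vel_le' K0 \<rho>(1) series J small y_near y_deriv st]
    show "(\<lambda>\<tau>. norm ((1 / symmetry_factor \<tau>) *\<^sub>R
             (iterated_integral T x \<tau> s t *\<^sub>R elementary_differential f \<tau> (y s)))) summable_on UNIV"
      by (rule rep(1))
    show "((\<lambda>\<tau>. (1 / symmetry_factor \<tau>) *\<^sub>R
             (iterated_integral T x \<tau> s t *\<^sub>R elementary_differential f \<tau> (y s))) has_sum (y t - y s)) UNIV"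
      by (rule rep(2))
  qed (rule t0)+
qed

end
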